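(* Let $b>0$ and let $V\in L^1(\mathbb{R})$ satisfy $V\ge 0$ and $V\not\equiv 0$. Let $W_V=W_V(b)$ be the self-adjoint, semibounded operator on $L^2(\mathbb{R})$ associated with $W_0(b)-V$, where $W_0(b)=2\cosh(bP)$, $P=\mathrm{i}\frac{d}{dx}$. Then $W_V$ has at least one eigenvalue below $2$.
   Context: With the Fourier transform $\widehat\psi(k)=\int_{\mathbb{R}}e^{-2\pi\mathrm{i}kx}\psi(x)\,dx$, the operator $W_0(b)$ is the self-adjoint operator of multiplication by $2\cosh(2\pi bk)$ in Fourier space (so formally $(W_0(b)\psi)(x)=\psi(x+\mathrm{i}b)+\psi(x-\mathrm{i}b)$), with domain $\{\psi\in L^2(\mathbb{R}): 2\cosh(2\pi bk)\widehat\psi(k)\in L^2(\mathbb{R})\}$ and spectrum $[2,\infty)$. For real $V\in L^1(\mathbb{R})$, $W_0(b)-V$ is bounded from below on the common domain and $W_V(b)$ denotes its Friedrichs extension; its essential spectrum is $[2,\infty)$. *)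

theory Defs
  imports "HOL-Analysis.Analysis"
begin

text \<open>Work in Fourier space: the form domain of the Friedrichs extension W_V(b) is
  the form domain of W_0(b), i.e. all psi in L2 whose Fourier transform phi satisfies
  int cosh(2 pi b k) |phi k|^2 dk < infinity.  Such phi are integrable, so psi is
  recovered pointwise as the inverse Fourier integral of phi.\<close>

definition four_inv :: "(real \<Rightarrow> complex) \<Rightarrow> real \<Rightarrow> complex" where
  "four_inv \<phi> x = (integral\<^sup>L lborel (\<lambda>k. cis (2 * pi * k * x) * \<phi> k))"

definition form_dom :: "real \<Rightarrow> (real \<Rightarrow> complex) set" where
  "form_dom b = {\<phi>. \<phi> \<in> borel_measurable lborel
      \<and> integrable lborel (\<lambda>k. (cmod (\<phi> k))\<^sup>2)
      \<and> integrable lborel (\<lambda>k. cosh (2 * pi * b * k) * (cmod (\<phi> k))\<^sup>2)}"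

definition WV_form :: "real \<Rightarrow> (real \<Rightarrow> real) \<Rightarrow> (real \<Rightarrow> complex) \<Rightarrow> (real \<Rightarrow> complex) \<Rightarrow> complex" where
  "WV_form b V \<phi> g =
     (integral\<^sup>L lborel (\<lambda>k. complex_of_real (2 * cosh (2 * pi * b * k)) * \<phi> k * cnj (g k)))
   - (integral\<^sup>L lborel (\<lambda>x. complex_of_real (V x) * four_inv \<phi> x * cnj (four_inv g x)))"

text \<open>lambda is an eigenvalue of the operator associated with the closed form
  (Friedrichs extension, Kato's representation theorem): there is a nonzero psi in the
  form domain with q[psi, chi] = lambda <psi, chi>_{L2} for all chi in the form domain.\<close>
definition is_eigenvalue_WV :: "real \<Rightarrow> (real \<Rightarrow> real) \<Rightarrow> real \<Rightarrow> bool" where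
  "is_eigenvalue_WV b V mu \<longleftrightarrow>
     (\<exists>\<phi>\<in>form_dom b. \<not> (AE k in lborel. \<phi> k = 0) \<and>
        (\<forall>g\<in>form_dom b. WV_form b V \<phi> g =
           complex_of_real mu * (integral\<^sup>L lborel (\<lambda>x. four_inv \<phi> x * cnj (four_inv g x)))))"

end

theory Submission
  imports
    Defs
    "HOL-Probability.Characteristic_Functions"
    "HOL-Probability.Sinc_Integral"
    "HOL-Complex_Analysis.Great_Picard"
begin

text \<open>The eigenvalue is the infimum \<open>\<lambda>\<close> of the quadratic form over normalised \<open>\<phi>\<close>. It is finite because
  \<open>\<integral> V |\<psi>|\<^sup>2 \<le> \<parallel>V\<parallel>\<^sub>1 \<parallel>\<phi>\<parallel>\<^sub>1\<^sup>2\<close> is form-bounded with relative bound below 1, and below 2 because for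
  \<open>\<phi>\<close> concentrated on \<open>[-d, d]\<close> the kinetic excess over 2 is of smaller order than the gain
  \<open>\<integral> V > 0\<close>. Let \<open>\<phi>\<^sub>n\<close> be a minimising sequence, and write \<open>V \<phi>\<close> also for the Fourier transform of \<open>V \<psi>\<close>.
  The functions \<open>V \<phi>\<^sub>n\<close> are uniformly bounded and equicontinuous in Fourier space, so a
  subsequence converges pointwise to some \<open>c\<close>. Evaluating the nonnegative form \<open>W\<^sub>V - \<lambda>\<close> at
  \<open>(W\<^sub>0 - \<lambda>)\<^sup>-\<^sup>1 V \<phi>\<^sub>n\<close> shows that \<open>\<phi>\<^sub>n - (W\<^sub>0 - \<lambda>)\<^sup>-\<^sup>1 V \<phi>\<^sub>n\<close> tends to 0 in the form norm; hence
  \<open>\<phi>\<^sub>n\<close> converges to \<open>\<eta> = (W\<^sub>0 - \<lambda>)\<^sup>-\<^sup>1 c\<close> in \<open>L\<^sup>1\<close> and \<open>c = V \<eta>\<close>. Since \<open>\<eta>\<close> is continuous and bounded,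
  Plancherel's identity for it follows by Gaussian regularisation.\<close>

section \<open>Integrals\<close>

lemma norm_cis_diff_one_le: "cmod (cis t - 1) \<le> \<bar>t\<bar>"
proof -
  have "cmod (cis t - 1) = 2 * \<bar>sin (t / 2)\<bar>"
    using dist_exp_i_1[of t] by (simp add: cis_conv_exp)
  also have "\<dots> \<le> \<bar>t\<bar>"
    using abs_sin_x_le_abs_x[of "t / 2"] by simp
  finally show ?thesis .
qed

lemma borel_measurable_cis [measurable (raw)]:
  "f \<in> borel_measurable M \<Longrightarrow> (\<lambda>x. cis (f x)) \<in> borel_measurable M"
  by (rule borel_measurable_continuous_on[where f = cis]) (auto intro!: continuous_intros)

lemma borel_measurable_cnj [measurable (raw)]:
  "f \<in> borel_measurable M \<Longrightarrow> (\<lambda>x. cnj (f x)) \<in> borel_measurable M"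
  by (rule borel_measurable_continuous_on[where f = cnj]) (auto intro!: continuous_intros)

lemma borel_measurable_cosh [measurable (raw)]:
  "f \<in> borel_measurable M \<Longrightarrow> (\<lambda>x. cosh (f x :: real)) \<in> borel_measurable M"
  by (rule borel_measurable_continuous_on[where f = cosh]) (auto intro!: continuous_intros)

lemma integrable_unimodular_mult:
  fixes u :: "real \<Rightarrow> complex"
  assumes u: "integrable lborel u" and K[measurable]: "K \<in> borel_measurable borel"
    and le: "\<And>x. cmod (K x) \<le> 1"
  shows "integrable lborel (\<lambda>x. K x * u x)"
proof (rule Bochner_Integration.integrable_bound[OF u])
  have [measurable]: "u \<in> borel_measurable borel"
    using borel_measurable_integrable[OF u] by simp
  show "(\<lambda>x. K x * u x) \<in> borel_measurable lborel" by measurable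
  show "AE x in lborel. norm (K x * u x) \<le> norm (u x)"
    using le by (auto simp: norm_mult intro!: mult_left_le_one_le)
qed

text \<open>The double integral converges absolutely because the kernel is bounded by 1 and both
  functions are integrable. With exponential kernels, this exchange serves \<open>pot_form\<close>
  and \<open>pot_gauss\<close>.\<close>

lemma Fubini_bounded_kernel:
  fixes u v :: "real \<Rightarrow> complex" and K :: "real \<Rightarrow> real \<Rightarrow> complex"
  assumes u: "integrable lborel u" and v: "integrable lborel v"
    and K[measurable]: "(\<lambda>(x, y). K x y) \<in> borel_measurable (borel \<Otimes>\<^sub>M borel)"
    and le: "\<And>x y. cmod (K x y) \<le> 1"
  shows "(\<integral>x. u x * (\<integral>k. K x k * v k \<partial>lborel) \<partial>lborel)
       = (\<integral>k. v k * (\<integral>x. K x k * u x \<partial>lborel) \<partial>lborel)"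
proof -
  have [measurable]: "u \<in> borel_measurable borel" "v \<in> borel_measurable borel"
    using borel_measurable_integrable[OF u] borel_measurable_integrable[OF v] by simp_all
  have "integrable (lborel \<Otimes>\<^sub>M lborel) (\<lambda>(x, k). u x * (K x k * v k))"
  proof (rule lborel_pair.Fubini_integrable)
    show "(\<lambda>(x, k). u x * (K x k * v k)) \<in> borel_measurable (lborel \<Otimes>\<^sub>M lborel)"
      by measurable
    have iK: "integrable lborel (\<lambda>k. K x k * v k)" for x
      by (rule integrable_unimodular_mult[OF v]) (auto simp: le)
    show "AE x in lborel. integrable lborel (\<lambda>y. case (x, y) of (x, k) \<Rightarrow> u x * (K x k * v k))"
      using iK by auto
    show "integrable lborel (\<lambda>x. \<integral>y. norm (case (x, y) of (x, k) \<Rightarrow> u x * (K x k * v k)) \<partial>lborel)"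
    proof (rule Bochner_Integration.integrable_bound)
      show "integrable lborel (\<lambda>x. cmod (u x) * (\<integral>k. cmod (v k) \<partial>lborel))"
        using u by simp
      have "(\<integral>k. cmod (u x) * (cmod (K x k) * cmod (v k)) \<partial>lborel) \<le> cmod (u x) * (\<integral>k. cmod (v k) \<partial>lborel)" for x
      proof -
        have "(\<integral>k. cmod (K x k) * cmod (v k) \<partial>lborel) \<le> (\<integral>k. cmod (v k) \<partial>lborel)"
          using iK[of x, THEN integrable_norm] v le
          by (intro integral_mono) (auto simp: norm_mult intro!: mult_left_le_one_le)
        then show ?thesis by (simp add: mult_left_mono)
      qed
      then show "AE x in lborel. norm (\<integral>y. norm (case (x, y) of (x, k) \<Rightarrow> u x * (K x k * v k)) \<partial>lborel)
          \<le> norm (cmod (u x) * (\<integral>k. cmod (v k) \<partial>lborel))"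
        by (auto simp: norm_mult abs_mult)
    qed measurable
  qed
  from lborel_pair.Fubini_integral[OF this]
  have "(\<integral>k. \<integral>x. u x * (K x k * v k) \<partial>lborel \<partial>lborel)
      = (\<integral>x. \<integral>k. u x * (K x k * v k) \<partial>lborel \<partial>lborel)" by simp
  moreover have "(\<integral>x. u x * (K x k * v k) \<partial>lborel) = v k * (\<integral>x. K x k * u x \<partial>lborel)" for k
    by (simp add: mult_ac flip: integral_mult_right_zero)
  ultimately show ?thesis by simp
qed

text \<open>For every real \<open>t\<close> the quotient
  \<open>(t - om k * cmod (f k))\<^sup>2 / om k\<close> is nonnegative. At \<open>t = 1\<close> this
  bounds \<open>cmod (f k)\<close> pointwise by an integrable function; integrated over
  \<open>k\<close> it is a nonnegative quadratic polynomial in \<open>t\<close>, which yields the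
  inequality.\<close>

lemma weighted_Cauchy_Schwarz:
  fixes f :: "real \<Rightarrow> complex" and om :: "real \<Rightarrow> real"
  assumes om: "\<And>k. 0 < om k" and J: "integrable lborel (\<lambda>k. 1 / om k)"
    and X: "integrable lborel (\<lambda>k. om k * (cmod (f k))\<^sup>2)"
    and f[measurable]: "f \<in> borel_measurable borel"
  shows "integrable lborel f"
    and "(\<integral>k. cmod (f k) \<partial>lborel)\<^sup>2 \<le> (\<integral>k. 1 / om k \<partial>lborel) * (\<integral>k. om k * (cmod (f k))\<^sup>2 \<partial>lborel)"
proof -
  have sq: "t\<^sup>2 * (1 / om k) - 2 * t * cmod (f k) + om k * (cmod (f k))\<^sup>2
      = (t - om k * cmod (f k))\<^sup>2 / om k" for t k
    using om[of k] by (simp add: field_simps power2_eq_square)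
  have nn: "0 \<le> t\<^sup>2 * (1 / om k) - 2 * t * cmod (f k) + om k * (cmod (f k))\<^sup>2" for t k
    unfolding sq using om[of k] by simp
  show If: "integrable lborel f"
  proof (rule Bochner_Integration.integrable_bound)
    show "integrable lborel (\<lambda>k. 1 / om k + om k * (cmod (f k))\<^sup>2)"
      using J X by simp
    show "AE k in lborel. norm (f k) \<le> norm (1 / om k + om k * (cmod (f k))\<^sup>2)"
    proof (rule AE_I2)
      fix k
      have "norm (f k) \<le> 1 / om k + om k * (cmod (f k))\<^sup>2"
        using nn[of 1 k] by simp (smt (verit) norm_ge_zero)
      then show "norm (f k) \<le> norm (1 / om k + om k * (cmod (f k))\<^sup>2)" by simp
    qed
  qed simp
  define I where "I = (\<integral>k. cmod (f k) \<partial>lborel)"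
  define J' where "J' = (\<integral>k. 1 / om k \<partial>lborel)"
  define X' where "X' = (\<integral>k. om k * (cmod (f k))\<^sup>2 \<partial>lborel)"
  have J0: "J' \<ge> 0" unfolding J'_def using om by (intro integral_nonneg_AE AE_I2) (simp add: less_imp_le)
  have I0: "I \<ge> 0" unfolding I_def by simp
  have q: "0 \<le> t\<^sup>2 * J' - 2 * t * I + X'" for t
  proof -
    have "0 \<le> (\<integral>k. t\<^sup>2 * (1 / om k) - 2 * t * cmod (f k) + om k * (cmod (f k))\<^sup>2 \<partial>lborel)"
      by (intro integral_nonneg_AE AE_I2 nn)
    also have "\<dots> = t\<^sup>2 * J' - 2 * t * I + X'"
      unfolding J'_def X'_def I_def using J X If by (simp del: times_divide_eq_right)
    finally show ?thesis .
  qed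
  have "I\<^sup>2 \<le> J' * X'"
  proof (cases "J' = 0")
    case True
    have "I = 0"
    proof (rule ccontr)
      assume "I \<noteq> 0"
      \<comment> \<open>With \<open>J' = 0\<close> the polynomial is affine in \<open>t\<close>; at
        this point its value is -1.\<close>
      then show False using q[of "(X' + 1) / (2 * I)"] True by simp
    qed
    then show ?thesis using True by simp
  next
    case False
    then have "J' > 0" using J0 by simp
    \<comment> \<open>The point \<open>I / J'\<close> is the minimiser of the quadratic
      polynomial.\<close>
    then show ?thesis using q[of "I / J'"] by (simp add: field_simps power2_eq_square)
  qed
  then show "(\<integral>k. cmod (f k) \<partial>lborel)\<^sup>2 \<le> (\<integral>k. 1 / om k \<partial>lborel) * (\<integral>k. om k * (cmod (f k))\<^sup>2 \<partial>lborel)"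
    unfolding I_def J'_def X'_def .
qed

section \<open>Fourier integrals\<close>

lemma four_inv_measurable:
  assumes [measurable]: "\<phi> \<in> borel_measurable borel"
  shows "four_inv \<phi> \<in> borel_measurable borel"
  unfolding four_inv_def by measurable

lemma four_inv_integrand:
  assumes "integrable lborel \<phi>"
  shows "integrable lborel (\<lambda>k. cis (2 * pi * k * x) * \<phi> k)"
  by (rule integrable_unimodular_mult[OF assms]) auto

lemma four_inv_bound:
  "cmod (four_inv \<phi> x) \<le> (\<integral>k. cmod (\<phi> k) \<partial>lborel)"
  unfolding four_inv_def
  using integral_norm_bound[of lborel "\<lambda>k. cis (2 * pi * k * x) * \<phi> k"] by (simp add: norm_mult)

lemma four_inv_diff:
  assumes "integrable lborel f" "integrable lborel g"
  shows "four_inv (\<lambda>k. f k - g k) x = four_inv f x - four_inv g x"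
  using four_inv_integrand[OF assms(1)] four_inv_integrand[OF assms(2)]
  by (simp add: four_inv_def right_diff_distrib)

lemma four_inv_scale: "four_inv (\<lambda>k. c * f k) x = c * four_inv f x"
  unfolding four_inv_def by (simp add: mult.left_commute)

text \<open>The phase at \<open>y\<close> factors out and has modulus 1, so the bound depends on
  \<open>x\<close> and \<open>y\<close> only through \<open>x - y\<close>. It gives continuity of a
  single Fourier integral, equicontinuity of a family, and the pointwise limit of the trial
  states.\<close>

lemma four_inv_oscillation:
  assumes "integrable lborel \<phi>"
  shows "cmod (four_inv \<phi> x - four_inv \<phi> y)
    \<le> (\<integral>k. cmod (\<phi> k) * cmod (cis (2 * pi * k * (x - y)) - 1) \<partial>lborel)"
proof -
  have "four_inv \<phi> x - four_inv \<phi> y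
      = (\<integral>k. cis (2 * pi * k * x) * \<phi> k - cis (2 * pi * k * y) * \<phi> k \<partial>lborel)"
    unfolding four_inv_def using four_inv_integrand[OF assms] by simp
  moreover have "cmod \<dots> \<le> (\<integral>k. cmod (cis (2 * pi * k * x) * \<phi> k - cis (2 * pi * k * y) * \<phi> k) \<partial>lborel)"
    by (rule integral_norm_bound)
  moreover have "cis (2 * pi * k * x) * \<phi> k - cis (2 * pi * k * y) * \<phi> k
      = cis (2 * pi * k * y) * (\<phi> k * (cis (2 * pi * k * (x - y)) - 1))" for k
  proof -
    have "cis (2 * pi * k * x) = cis (2 * pi * k * y) * cis (2 * pi * k * (x - y))"
      unfolding cis_mult by (simp add: algebra_simps)
    then show ?thesis by (simp add: algebra_simps)
  qed
  ultimately show ?thesis by (simp add: norm_mult)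
qed

lemma oscillation_tendsto_0:
  fixes u :: "real \<Rightarrow> real"
  assumes u: "integrable lborel u" and h: "h \<longlonglongrightarrow> 0"
  shows "(\<lambda>n. \<integral>k. \<bar>u k\<bar> * cmod (cis (2 * pi * k * h n) - 1) \<partial>lborel) \<longlonglongrightarrow> 0"
proof -
  have [measurable]: "u \<in> borel_measurable borel"
    using borel_measurable_integrable[OF u] by simp
  have "(\<lambda>n. \<integral>k. \<bar>u k\<bar> * cmod (cis (2 * pi * k * h n) - 1) \<partial>lborel) \<longlonglongrightarrow> (\<integral>k. 0 \<partial>(lborel::real measure))"
  proof (rule integral_dominated_convergence[where w = "\<lambda>k. \<bar>u k\<bar> * 2"])
    show "integrable lborel (\<lambda>k. \<bar>u k\<bar> * 2)" using u by simp
    show "AE k in lborel. (\<lambda>n. \<bar>u k\<bar> * cmod (cis (2 * pi * k * h n) - 1)) \<longlonglongrightarrow> 0"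
    proof (rule AE_I2)
      fix k
      have "(\<lambda>n. \<bar>u k\<bar> * cmod (cis (2 * pi * k * h n) - 1)) \<longlonglongrightarrow> \<bar>u k\<bar> * cmod (cis (2 * pi * k * 0) - 1)"
        unfolding cis_conv_exp by (intro tendsto_intros h)
      then show "(\<lambda>n. \<bar>u k\<bar> * cmod (cis (2 * pi * k * h n) - 1)) \<longlonglongrightarrow> 0" by simp
    qed
    show "AE k in lborel. norm (\<bar>u k\<bar> * cmod (cis (2 * pi * k * h n) - 1)) \<le> \<bar>u k\<bar> * 2" for n
      using norm_triangle_ineq4[of "cis _" 1] by (auto simp: abs_mult intro!: mult_left_mono)
  qed simp_all
  then show ?thesis by simp
qed

lemma continuous_four_inv:
  assumes "integrable lborel \<phi>"
  shows "continuous_on UNIV (four_inv \<phi>)"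
proof (clarsimp simp: continuous_on_sequentially o_def)
  fix x :: "nat \<Rightarrow> real" and a assume "x \<longlonglongrightarrow> a"
  then have "(\<lambda>n. x n - a) \<longlonglongrightarrow> 0" by (simp add: LIM_zero)
  from oscillation_tendsto_0[OF integrable_norm[OF assms] this]
  have "(\<lambda>n. \<integral>k. cmod (\<phi> k) * cmod (cis (2 * pi * k * (x n - a)) - 1) \<partial>lborel) \<longlonglongrightarrow> 0" by simp
  then have "(\<lambda>n. four_inv \<phi> (x n) - four_inv \<phi> a) \<longlonglongrightarrow> 0"
    by (rule Lim_null_comparison[rotated]) (simp add: four_inv_oscillation[OF assms])
  then show "(\<lambda>n. four_inv \<phi> (x n)) \<longlonglongrightarrow> four_inv \<phi> a" by (simp add: LIM_zero_iff)
qed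

text \<open>This is the pointwise part of the Arzela-Ascoli argument on the whole line: a diagonal
  subsequence converges at all rationals, and the common modulus of continuity carries the Cauchy
  property over to every real point.\<close>

lemma equicontinuous_convergent_subseq:
  fixes f :: "nat \<Rightarrow> real \<Rightarrow> complex" and \<omega> :: "real \<Rightarrow> real"
  assumes bd: "\<And>n x. cmod (f n x) \<le> M"
    and eq: "\<And>n x y. cmod (f n x - f n y) \<le> \<omega> (x - y)"
    and \<omega>: "\<And>h. h \<longlonglongrightarrow> 0 \<Longrightarrow> (\<lambda>n. \<omega> (h n)) \<longlonglongrightarrow> 0"
  obtains r c where "strict_mono (r :: nat \<Rightarrow> nat)" "\<And>x. (\<lambda>n. f (r n) x) \<longlonglongrightarrow> c x"
proof -
  obtain r where r: "strict_mono (r :: nat \<Rightarrow> nat)"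
      and q: "\<And>x. x \<in> \<rat> \<Longrightarrow> \<exists>l. (\<lambda>n. f (r n) x) \<longlonglongrightarrow> l"
    by (rule function_convergent_subsequence[OF countable_rat, of f M]) (use bd in auto)
  have "\<exists>l. (\<lambda>n. f (r n) x) \<longlonglongrightarrow> l" for x
  proof -
    have "Cauchy (\<lambda>n. f (r n) x)"
    proof (rule metric_CauchyI)
      fix e :: real assume e: "e > 0"
      \<comment> \<open>Rationals tending to \<open>x\<close> from the right. At one of them the
        modulus is below \<open>e / 4\<close>; it is spent twice, once for each index, and the
        Cauchy property at that rational costs another \<open>e / 4\<close>.\<close>
      have "\<exists>y\<in>\<rat>. x < y \<and> y < x + 1 / real (Suc n)" for n
        using Rats_dense_in_real[of x "x + 1 / real (Suc n)"] by auto
      then obtain y where y: "\<And>n. y n \<in> \<rat>" "\<And>n. x < y n" "\<And>n. y n < x + 1 / real (Suc n)"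
        by metis
      have "(\<lambda>n. x - y n) \<longlonglongrightarrow> 0"
      proof (rule Lim_null_comparison)
        show "\<forall>\<^sub>F n in sequentially. norm (x - y n) \<le> inverse (real (Suc n))"
          using y(2,3) by (auto simp: abs_if inverse_eq_divide algebra_simps intro!: always_eventually less_imp_le)
      qed (rule LIMSEQ_inverse_real_of_nat)
      from \<omega>[OF this] have "\<forall>\<^sub>F n in sequentially. dist (\<omega> (x - y n)) 0 < e / 4"
        using e by (auto dest: tendstoD[where e = "e / 4"])
      then obtain n where "dist (\<omega> (x - y n)) 0 < e / 4"
        unfolding eventually_sequentially by blast
      then have n: "\<omega> (x - y n) < e / 4"
        by (simp add: dist_real_def)
      have "Cauchy (\<lambda>m. f (r m) (y n))"
        using q[OF y(1)] convergent_def convergent_eq_Cauchy by blast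
      then obtain N where N: "\<And>m m'. m \<ge> N \<Longrightarrow> m' \<ge> N \<Longrightarrow> dist (f (r m) (y n)) (f (r m') (y n)) < e / 4"
        using e by (metis metric_CauchyD divide_pos_pos zero_less_numeral)
      have "dist (f (r m) x) (f (r m') x) < e" if "m \<ge> N" "m' \<ge> N" for m m'
        using N[OF that] eq[of "r m" x "y n"] eq[of "r m'" x "y n"] n
          dist_triangle[of "f (r m) x" "f (r m') x" "f (r m) (y n)"]
          dist_triangle[of "f (r m) (y n)" "f (r m') x" "f (r m') (y n)"]
          dist_commute[of "f (r m') (y n)" "f (r m') x"] e
        unfolding dist_norm[of "f _ x" "f _ (y n)"] by linarith
      then show "\<exists>M. \<forall>m\<ge>M. \<forall>m'\<ge>M. dist (f (r m) x) (f (r m') x) < e" by blast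
    qed
    then show ?thesis using convergent_eq_Cauchy by blast
  qed
  then show ?thesis using r that by metis
qed

section \<open>The form domain\<close>

text \<open>The Fourier multiplier of the free operator W_0(b).\<close>

abbreviation wt :: "real \<Rightarrow> real \<Rightarrow> real" where
  "wt b k \<equiv> 2 * cosh (2 * pi * b * k)"

lemma wt_ge_2: "2 \<le> wt b k"
  using cosh_real_ge_1[of "2 * pi * b * k"] by simp

lemma integrable_inverse_one_plus_square: "integrable lborel (\<lambda>x::real. inverse (1 + x\<^sup>2))"
  using integrable_inverse_1_plus_square by (simp add: set_integrable_def)

text \<open>The exponential growth of \<open>cosh\<close> beats a quadratic, so a rescaled Cauchy
  density dominates \<open>1 / om\<close>. The constant \<open>\<kappa>\<close> admits both the
  raised weights \<open>n + wt b k\<close> and the resolvent weights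
  \<open>wt b k - lam\<close>.\<close>

lemma integrable_inverse_wt:
  assumes b: "b > 0" and \<kappa>: "\<kappa> > 0"
    and om[measurable]: "om \<in> borel_measurable borel" and le: "\<And>k. \<kappa> * wt b k \<le> om k"
  shows "integrable lborel (\<lambda>k. 1 / om k)"
proof (rule Bochner_Integration.integrable_bound)
  let ?a = "2 * pi * b"
  have "integrable lborel (\<lambda>k. inverse (1 + (0 + ?a * k)\<^sup>2))"
    using b by (intro lborel_integrable_real_affine integrable_inverse_one_plus_square) simp
  then show "integrable lborel (\<lambda>k. (2 / \<kappa>) * inverse (1 + (?a * k)\<^sup>2))" by simp
  show "AE k in lborel. norm (1 / om k) \<le> norm ((2 / \<kappa>) * inverse (1 + (?a * k)\<^sup>2))"
  proof (rule AE_I2)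
    fix k
    \<comment> \<open>The second-order Taylor bound for \<open>exp\<close>; the linear term is
      dropped afterwards and the rest weakened to \<open>(1 + (?a * k)\<^sup>2) / 2\<close>.\<close>
    have "1 + \<bar>?a * k\<bar> + \<bar>?a * k\<bar>\<^sup>2 / 2 \<le> exp \<bar>?a * k\<bar>"
      by (rule exp_lower_Taylor_quadratic) simp
    also have "\<dots> \<le> wt b k"
      by (subst cosh_real_abs[symmetric]) (simp add: cosh_field_def)
    finally have "(1 + (?a * k)\<^sup>2) / 2 \<le> wt b k" by simp
    then have "\<kappa> * ((1 + (?a * k)\<^sup>2) / 2) \<le> om k"
      using le[of k] \<kappa> by (smt (verit) mult_left_mono)
    moreover have "0 < \<kappa> * ((1 + (?a * k)\<^sup>2) / 2)"
      using \<kappa> by (simp add: add_pos_nonneg)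
    ultimately have "1 / om k \<le> 1 / (\<kappa> * ((1 + (?a * k)\<^sup>2) / 2))" "om k > 0"
      by (intro frac_le, linarith+)
    then show "norm (1 / om k) \<le> norm ((2 / \<kappa>) * inverse (1 + (?a * k)\<^sup>2))"
      using \<kappa> by (simp add: field_simps)
  qed
qed measurable

lemma form_dom_iff:
  "\<phi> \<in> form_dom b \<longleftrightarrow>
    \<phi> \<in> borel_measurable borel \<and> integrable lborel (\<lambda>k. wt b k * (cmod (\<phi> k))\<^sup>2)"
proof -
  have "integrable lborel (\<lambda>k. (cmod (\<phi> k))\<^sup>2)"
    if [measurable]: "\<phi> \<in> borel_measurable borel"
      and i: "integrable lborel (\<lambda>k. cosh (2 * pi * b * k) * (cmod (\<phi> k))\<^sup>2)"
  proof (rule Bochner_Integration.integrable_bound[OF i])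
    show "AE k in lborel. norm ((cmod (\<phi> k))\<^sup>2) \<le> norm (cosh (2 * pi * b * k) * (cmod (\<phi> k))\<^sup>2)"
      using cosh_real_ge_1 by (intro AE_I2) (auto simp: abs_mult intro!: mult_le_cancel_right1[THEN iffD2])
  qed measurable
  then show ?thesis
    unfolding form_dom_def by (auto simp: mult.assoc)
qed

lemma form_dom_measurable: "\<phi> \<in> form_dom b \<Longrightarrow> \<phi> \<in> borel_measurable borel"
  by (simp add: form_dom_iff)

lemma form_dom_wt: "\<phi> \<in> form_dom b \<Longrightarrow> integrable lborel (\<lambda>k. wt b k * (cmod (\<phi> k))\<^sup>2)"
  by (simp add: form_dom_iff)

lemma form_dom_square: "\<phi> \<in> form_dom b \<Longrightarrow> integrable lborel (\<lambda>k. (cmod (\<phi> k))\<^sup>2)"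
  by (simp add: form_dom_def)

text \<open>Cauchy-Schwarz against the integrable function \<open>1 / wt b k\<close>. This makes
  \<open>four_inv\<close> an absolutely convergent integral on the form domain.\<close>

lemma form_dom_integrable: "b > 0 \<Longrightarrow> \<phi> \<in> form_dom b \<Longrightarrow> integrable lborel \<phi>"
  by (rule weighted_Cauchy_Schwarz(1)[of "wt b"])
    (simp, rule integrable_inverse_wt[of b 1],
     simp_all only: form_dom_measurable form_dom_wt mult_1 order_refl zero_less_one, simp)

lemma form_dom_sesquilinear_integrable:
  fixes u :: "real \<Rightarrow> complex"
  assumes "\<phi> \<in> form_dom b" "g \<in> form_dom b"
    and [measurable]: "u \<in> borel_measurable borel" and u: "\<And>k. cmod (u k) \<le> C * wt b k"
  shows "integrable lborel (\<lambda>k. u k * \<phi> k * cnj (g k))"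
proof (rule Bochner_Integration.integrable_bound)
  have [measurable]: "\<phi> \<in> borel_measurable borel" "g \<in> borel_measurable borel"
    using assms(1,2) by (auto dest: form_dom_measurable)
  show "(\<lambda>k. u k * \<phi> k * cnj (g k)) \<in> borel_measurable lborel" by measurable
  show "integrable lborel (\<lambda>k. C * (wt b k * (cmod (\<phi> k))\<^sup>2 + wt b k * (cmod (g k))\<^sup>2))"
    by (intro integrable_mult_right Bochner_Integration.integrable_add form_dom_wt assms)
  show "AE k in lborel. norm (u k * \<phi> k * cnj (g k))
      \<le> norm (C * (wt b k * (cmod (\<phi> k))\<^sup>2 + wt b k * (cmod (g k))\<^sup>2))"
  proof (rule AE_I2)
    fix k
    have am: "cmod (\<phi> k) * cmod (g k) \<le> (cmod (\<phi> k))\<^sup>2 + (cmod (g k))\<^sup>2"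
      using sum_squares_bound[of "cmod (\<phi> k)" "cmod (g k)"]
        mult_nonneg_nonneg[of "cmod (\<phi> k)" "cmod (g k)"] norm_ge_zero[of "\<phi> k"] norm_ge_zero[of "g k"]
      by linarith
    have "norm (u k * \<phi> k * cnj (g k)) = cmod (u k) * (cmod (\<phi> k) * cmod (g k))"
      by (simp add: norm_mult)
    also have "\<dots> \<le> (C * wt b k) * ((cmod (\<phi> k))\<^sup>2 + (cmod (g k))\<^sup>2)"
      using u[of k] order_trans[OF norm_ge_zero u, of k] by (intro mult_mono am) simp_all
    also have "\<dots> = C * (wt b k * (cmod (\<phi> k))\<^sup>2 + wt b k * (cmod (g k))\<^sup>2)"
      by (simp add: algebra_simps)
    finally show "norm (u k * \<phi> k * cnj (g k))
      \<le> norm (C * (wt b k * (cmod (\<phi> k))\<^sup>2 + wt b k * (cmod (g k))\<^sup>2))" by simp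
  qed
qed

lemma cmod_diff_square_le: "(cmod (x - y))\<^sup>2 \<le> 2 * (cmod x)\<^sup>2 + 2 * (cmod y)\<^sup>2"
proof -
  have "(cmod (x - y))\<^sup>2 \<le> (cmod x + cmod y)\<^sup>2"
    by (intro power_mono norm_triangle_ineq4) simp
  also have "\<dots> \<le> 2 * (cmod x)\<^sup>2 + 2 * (cmod y)\<^sup>2"
    using sum_squares_bound[of "cmod x" "cmod y"] by (simp add: power2_sum)
  finally show ?thesis .
qed

lemma form_dom_diff:
  assumes "\<phi> \<in> form_dom b" "g \<in> form_dom b"
  shows "(\<lambda>k. \<phi> k - g k) \<in> form_dom b"
  unfolding form_dom_iff
proof
  have [measurable]: "\<phi> \<in> borel_measurable borel" "g \<in> borel_measurable borel"
    using assms by (auto dest: form_dom_measurable)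
  show "(\<lambda>k. \<phi> k - g k) \<in> borel_measurable borel" by measurable
  show "integrable lborel (\<lambda>k. wt b k * (cmod (\<phi> k - g k))\<^sup>2)"
  proof (rule Bochner_Integration.integrable_bound)
    show "integrable lborel (\<lambda>k. 2 * (wt b k * (cmod (\<phi> k))\<^sup>2) + 2 * (wt b k * (cmod (g k))\<^sup>2))"
      by (intro integrable_mult_right Bochner_Integration.integrable_add form_dom_wt assms)
    have "wt b k * (cmod (\<phi> k - g k))\<^sup>2 \<le> wt b k * (2 * (cmod (\<phi> k))\<^sup>2 + 2 * (cmod (g k))\<^sup>2)" for k
      by (intro mult_left_mono cmod_diff_square_le) simp
    then show "AE k in lborel. norm (wt b k * (cmod (\<phi> k - g k))\<^sup>2)
       \<le> norm (2 * (wt b k * (cmod (\<phi> k))\<^sup>2) + 2 * (wt b k * (cmod (g k))\<^sup>2))"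
      by (auto simp: abs_mult algebra_simps)
  qed measurable
qed

lemma form_dom_scale: "\<phi> \<in> form_dom b \<Longrightarrow> (\<lambda>k. c * \<phi> k) \<in> form_dom b"
  unfolding form_dom_iff
  using integrable_mult_right[of "(cmod c)\<^sup>2" lborel "\<lambda>k. wt b k * (cmod (\<phi> k))\<^sup>2"]
  by (auto simp: norm_mult power_mult_distrib mult_ac)

section \<open>The potential term\<close>

text \<open>The Fourier transform of V times the inverse transform of \<open>\<phi>\<close>, that
  is, the potential acting in Fourier space. The forward transform is \<open>four_inv\<close>
  evaluated at the reflected point.\<close>

definition pot :: "(real \<Rightarrow> real) \<Rightarrow> (real \<Rightarrow> complex) \<Rightarrow> real \<Rightarrow> complex" where
  "pot V \<phi> k = four_inv (\<lambda>x. complex_of_real (V x) * four_inv \<phi> x) (- k)"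

definition pot_energy :: "(real \<Rightarrow> real) \<Rightarrow> (real \<Rightarrow> complex) \<Rightarrow> real" where
  "pot_energy V \<phi> = (\<integral>x. V x * (cmod (four_inv \<phi> x))\<^sup>2 \<partial>lborel)"

lemma integrable_bounded_mult:
  fixes V :: "real \<Rightarrow> real" and f :: "real \<Rightarrow> complex"
  assumes V: "integrable lborel V" and [measurable]: "f \<in> borel_measurable borel"
    and le: "\<And>x. cmod (f x) \<le> C"
  shows "integrable lborel (\<lambda>x. complex_of_real (V x) * f x)"
proof (rule Bochner_Integration.integrable_bound)
  have [measurable]: "V \<in> borel_measurable borel"
    using borel_measurable_integrable[OF V] by simp
  show "integrable lborel (\<lambda>x. C * V x)" using V by simp
  have "\<bar>V x\<bar> * cmod (f x) \<le> \<bar>C\<bar> * \<bar>V x\<bar>" for x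
    using le[of x] by (subst mult.commute) (intro mult_right_mono, auto)
  then show "AE x in lborel. norm (complex_of_real (V x) * f x) \<le> norm (C * V x)"
    by (auto simp: norm_mult abs_mult)
  show "(\<lambda>x. complex_of_real (V x) * f x) \<in> borel_measurable lborel" by measurable
qed

lemma integrable_V_four_inv:
  assumes "integrable lborel V" "integrable lborel \<phi>"
  shows "integrable lborel (\<lambda>x. complex_of_real (V x) * four_inv \<phi> x)"
  using borel_measurable_integrable[OF assms(2)]
  by (intro integrable_bounded_mult[OF assms(1) _ four_inv_bound] four_inv_measurable) simp

lemma integrable_V_four_inv2:
  assumes "integrable lborel V" "integrable lborel \<phi>" "integrable lborel g"
  shows "integrable lborel (\<lambda>x. complex_of_real (V x) * four_inv \<phi> x * cnj (four_inv g x))"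
proof -
  have [measurable]: "\<phi> \<in> borel_measurable borel" "g \<in> borel_measurable borel"
      "four_inv \<phi> \<in> borel_measurable borel" "four_inv g \<in> borel_measurable borel"
    using borel_measurable_integrable[OF assms(2)] borel_measurable_integrable[OF assms(3)]
    by (auto intro: four_inv_measurable)
  have "cmod (four_inv \<phi> x * cnj (four_inv g x))
      \<le> (\<integral>k. cmod (\<phi> k) \<partial>lborel) * (\<integral>k. cmod (g k) \<partial>lborel)" for x
    unfolding norm_mult complex_mod_cnj by (intro mult_mono four_inv_bound) auto
  then have "integrable lborel (\<lambda>x. complex_of_real (V x) * (four_inv \<phi> x * cnj (four_inv g x)))"
    by (intro integrable_bounded_mult[OF assms(1)]) measurable
  then show ?thesis by (simp add: mult.assoc)
qed

lemma continuous_pot: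
  assumes "integrable lborel V" "integrable lborel \<phi>"
  shows "continuous_on UNIV (pot V \<phi>)"
proof -
  have "continuous_on UNIV (four_inv (\<lambda>x. complex_of_real (V x) * four_inv \<phi> x) \<circ> uminus)"
    by (intro continuous_on_compose continuous_intros
        continuous_on_subset[OF continuous_four_inv[OF integrable_V_four_inv[OF assms]]]) auto
  then show ?thesis by (simp add: pot_def[abs_def] o_def)
qed

lemma norm_V_four_inv_le:
  "cmod (complex_of_real (V x) * four_inv \<phi> x) \<le> \<bar>V x\<bar> * (\<integral>k. cmod (\<phi> k) \<partial>lborel)"
  unfolding norm_mult norm_of_real by (intro mult_left_mono four_inv_bound) simp

lemma pot_bound:
  assumes "integrable lborel V" "integrable lborel \<phi>"
  shows "cmod (pot V \<phi> k) \<le> (\<integral>x. \<bar>V x\<bar> \<partial>lborel) * (\<integral>k. cmod (\<phi> k) \<partial>lborel)"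
proof -
  have "cmod (pot V \<phi> k) \<le> (\<integral>x. cmod (complex_of_real (V x) * four_inv \<phi> x) \<partial>lborel)"
    unfolding pot_def by (rule four_inv_bound)
  also have "\<dots> \<le> (\<integral>x. \<bar>V x\<bar> * (\<integral>k. cmod (\<phi> k) \<partial>lborel) \<partial>lborel)"
    using assms by (intro integral_mono integrable_norm integrable_V_four_inv norm_V_four_inv_le) auto
  finally show ?thesis by simp
qed

text \<open>The modulus of continuity involves \<open>\<phi>\<close> only through the bound
  \<open>C\<close> on its \<open>L\<^sup>1\<close> norm, hence it is shared by all members of a
  minimising sequence.\<close>

lemma pot_oscillation:
  assumes "integrable lborel V" "integrable lborel \<phi>"
    and C: "(\<integral>k. cmod (\<phi> k) \<partial>lborel) \<le> C"
  shows "cmod (pot V \<phi> k - pot V \<phi> l)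
    \<le> C * (\<integral>x. \<bar>V x\<bar> * cmod (cis (2 * pi * x * (l - k)) - 1) \<partial>lborel)"
proof -
  have [measurable]: "V \<in> borel_measurable borel"
    using borel_measurable_integrable[OF assms(1)] by simp
  let ?d = "\<lambda>x. cmod (cis (2 * pi * x * (- k - (- l))) - 1)"
  have i: "integrable lborel (\<lambda>x. cmod (complex_of_real (V x * cmod z) * (cis (2 * pi * x * (- k - (- l))) - 1)))" for z
    by (rule integrable_norm, rule integrable_bounded_mult[where C = 2])
      (use assms(1) norm_triangle_ineq4[of "cis _" 1] in auto)
  have V: "cmod (complex_of_real (V x) * four_inv \<phi> x) \<le> C * \<bar>V x\<bar>" for x
    using norm_V_four_inv_le[of V x \<phi>] mult_left_mono[OF C, of "\<bar>V x\<bar>"] by (simp add: mult.commute)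
  have "cmod (pot V \<phi> k - pot V \<phi> l)
      \<le> (\<integral>x. cmod (complex_of_real (V x) * four_inv \<phi> x) * ?d x \<partial>lborel)"
    unfolding pot_def by (rule four_inv_oscillation[OF integrable_V_four_inv[OF assms(1,2)]])
  also have "\<dots> \<le> (\<integral>x. C * (\<bar>V x\<bar> * ?d x) \<partial>lborel)"
  proof (rule integral_mono')
    show "integrable lborel (\<lambda>x. C * (\<bar>V x\<bar> * ?d x))"
      using i[of 1] by (simp add: norm_mult)
    show "cmod (complex_of_real (V x) * four_inv \<phi> x) * ?d x \<le> C * (\<bar>V x\<bar> * ?d x)" for x
      using mult_right_mono[OF V norm_ge_zero, of x "cis (2 * pi * x * (- k - (- l))) - 1"]
      by (simp add: mult.assoc)
  qed (smt (verit) V norm_ge_zero mult_nonneg_nonneg mult.assoc)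
  finally show ?thesis by simp
qed

text \<open>Conjugation reverses the phase in \<open>four_inv g\<close>, and Fubini moves that
  integral onto V times \<open>four_inv \<phi>\<close>. The potential form thus becomes a
  Fourier-space pairing, comparable with the kinetic form.\<close>

lemma pot_form:
  assumes V: "integrable lborel V" and \<phi>: "integrable lborel \<phi>" and g: "integrable lborel g"
  shows "(\<integral>x. complex_of_real (V x) * four_inv \<phi> x * cnj (four_inv g x) \<partial>lborel)
       = (\<integral>k. pot V \<phi> k * cnj (g k) \<partial>lborel)"
proof -
  have "cnj (four_inv g x) = (\<integral>k. cis (2 * pi * x * (- k)) * cnj (g k) \<partial>lborel)" for x
    unfolding four_inv_def
    by (subst Bochner_Integration.integral_cnj[symmetric]) (rule Bochner_Integration.integral_cong, auto simp: cis_cnj mult_ac)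
  moreover have "pot V \<phi> k = (\<integral>x. cis (2 * pi * x * (- k)) * (complex_of_real (V x) * four_inv \<phi> x) \<partial>lborel)" for k
    unfolding pot_def by (subst four_inv_def) simp
  ultimately show ?thesis
    using Fubini_bounded_kernel[of "\<lambda>x. complex_of_real (V x) * four_inv \<phi> x" "\<lambda>k. cnj (g k)"
       "\<lambda>x k. cis (2 * pi * x * (- k))"] integrable_V_four_inv[OF V \<phi>] g
    by (simp add: mult.commute)
qed

lemma pot_energy_nonneg: "AE x in lborel. V x \<ge> 0 \<Longrightarrow> 0 \<le> pot_energy V \<phi>"
  unfolding pot_energy_def by (intro integral_nonneg_AE) auto

lemma pot_energy_integrable:
  assumes "integrable lborel V" "integrable lborel \<phi>"
  shows "integrable lborel (\<lambda>x. V x * (cmod (four_inv \<phi> x))\<^sup>2)"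
proof -
  have "complex_of_real (V x) * four_inv \<phi> x * cnj (four_inv \<phi> x)
      = complex_of_real (V x * (cmod (four_inv \<phi> x))\<^sup>2)" for x
    by (simp only: of_real_mult complex_norm_square mult.assoc)
  then show ?thesis
    using integrable_V_four_inv2[OF assms(1) assms(2) assms(2)]
    by (simp only: complex_of_real_integrable_eq)
qed

lemma pot_energy_le:
  assumes "integrable lborel V" "integrable lborel \<phi>"
  shows "pot_energy V \<phi> \<le> (\<integral>x. \<bar>V x\<bar> \<partial>lborel) * (\<integral>k. cmod (\<phi> k) \<partial>lborel)\<^sup>2"
proof -
  have "pot_energy V \<phi> \<le> (\<integral>x. \<bar>V x\<bar> * (\<integral>k. cmod (\<phi> k) \<partial>lborel)\<^sup>2 \<partial>lborel)"
    unfolding pot_energy_def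
  proof (rule integral_mono)
    show "V x * (cmod (four_inv \<phi> x))\<^sup>2 \<le> \<bar>V x\<bar> * (\<integral>k. cmod (\<phi> k) \<partial>lborel)\<^sup>2" for x
      by (intro mult_mono power_mono four_inv_bound) auto
  qed (use assms in \<open>auto intro: pot_energy_integrable\<close>)
  then show ?thesis by simp
qed

text \<open>The square is expanded in position space and the cross term is then moved to Fourier
  space by \<open>pot_form\<close>, where it can cancel against a kinetic cross term.\<close>

lemma pot_energy_diff:
  assumes V: "integrable lborel V" and \<phi>: "integrable lborel \<phi>" and e: "integrable lborel e"
  shows "pot_energy V (\<lambda>k. \<phi> k - e k)
    = pot_energy V \<phi> - 2 * Re (\<integral>k. pot V \<phi> k * cnj (e k) \<partial>lborel) + pot_energy V e"
proof -
  let ?f = "four_inv \<phi>" and ?h = "four_inv e"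
  have sq: "(cmod (x - y))\<^sup>2 = (cmod x)\<^sup>2 - 2 * Re (x * cnj y) + (cmod y)\<^sup>2" for x y
    unfolding cmod_power2 by (simp add: power2_eq_square algebra_simps)
  let ?R = "\<lambda>x. Re (complex_of_real (V x) * ?f x * cnj (?h x))"
  have "V x * (cmod (four_inv (\<lambda>k. \<phi> k - e k) x))\<^sup>2
      = V x * (cmod (?f x))\<^sup>2 - 2 * ?R x + V x * (cmod (?h x))\<^sup>2" for x
    unfolding four_inv_diff[OF \<phi> e] sq by (simp add: algebra_simps)
  then have "pot_energy V (\<lambda>k. \<phi> k - e k)
      = (\<integral>x. V x * (cmod (?f x))\<^sup>2 - 2 * ?R x + V x * (cmod (?h x))\<^sup>2 \<partial>lborel)"
    unfolding pot_energy_def by simp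
  also have "\<dots> = pot_energy V \<phi> - 2 * (\<integral>x. ?R x \<partial>lborel) + pot_energy V e"
    unfolding pot_energy_def
    using pot_energy_integrable[OF V \<phi>] pot_energy_integrable[OF V e]
      integrable_Re[OF integrable_V_four_inv2[OF assms]]
    by (simp only: Bochner_Integration.integral_add Bochner_Integration.integral_diff
        Bochner_Integration.integrable_diff integrable_mult_right integral_mult_right_zero)
  also have "(\<integral>x. ?R x \<partial>lborel) = Re (\<integral>x. complex_of_real (V x) * ?f x * cnj (?h x) \<partial>lborel)"
    by (rule Bochner_Integration.integral_Re[OF integrable_V_four_inv2[OF assms]])
  finally show ?thesis unfolding pot_form[OF assms] .
qed

section \<open>Plancherel's identity by Gaussian regularisation\<close>

text \<open>For positive \<open>d\<close> this is the Fourier transform of the centred normal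
  density of standard deviation \<open>d\<close>. It tends to 1 pointwise as \<open>d\<close> tends
  to 0.\<close>

definition gauss :: "real \<Rightarrow> real \<Rightarrow> real" where
  "gauss d x = exp (- (2 * pi * d * x)\<^sup>2 / 2)"

lemma gauss_std_normal: "gauss d x = sqrt (2 * pi) * std_normal_density (2 * pi * d * x)"
  unfolding gauss_def std_normal_density_def by simp

lemma integrable_std_normal: "integrable lborel std_normal_density"
  by (rule integrable_normal_density) simp

lemma integrable_gauss: "d > 0 \<Longrightarrow> integrable lborel (gauss d)"
proof -
  assume d: "d > 0"
  have "integrable lborel (\<lambda>x. std_normal_density (0 + (2 * pi * d) * x))"
    using d by (intro lborel_integrable_real_affine integrable_std_normal) simp
  then show ?thesis unfolding gauss_std_normal[abs_def] by simp
qed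

lemma fourier_std_normal:
  "(\<integral>s. cis (t * s) * complex_of_real (std_normal_density s) \<partial>lborel) = complex_of_real (exp (- t\<^sup>2 / 2))"
proof -
  have "complex_of_real (exp (- t\<^sup>2 / 2)) = char std_normal_distribution t"
    by (simp add: char_std_normal_distribution)
  also have "\<dots> = (\<integral>s. std_normal_density s *\<^sub>R cis (t * s) \<partial>lborel)"
    unfolding char_def by (subst integral_density) (auto simp: normal_density_nonneg cis_conv_exp)
  finally show ?thesis by (simp add: scaleR_conv_of_real mult.commute)
qed

text \<open>The substitution \<open>x = s / (2 * pi * d)\<close> reduces the integral to the
  characteristic function of the standard normal law, which is again Gaussian.\<close>

lemma four_inv_gauss:
  assumes d: "d > 0"
  shows "four_inv (\<lambda>x. complex_of_real (gauss d x)) h = complex_of_real (std_normal_density (h / d) / d)"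
proof -
  let ?c = "1 / (2 * pi * d)"
  have "four_inv (\<lambda>x. complex_of_real (gauss d x)) h
    = \<bar>?c\<bar> *\<^sub>R (\<integral>s. cis (2 * pi * (0 + ?c * s) * h) * complex_of_real (gauss d (0 + ?c * s)) \<partial>lborel)"
    unfolding four_inv_def using d by (intro lborel_integral_real_affine) simp
  also have "\<dots> = ?c *\<^sub>R (\<integral>s. complex_of_real (sqrt (2 * pi)) * (cis ((h / d) * s) * complex_of_real (std_normal_density s)) \<partial>lborel)"
    using d unfolding gauss_std_normal by (simp add: field_simps)
  also have "\<dots> = complex_of_real (?c * sqrt (2 * pi) * exp (- (h / d)\<^sup>2 / 2))"
    unfolding integral_mult_right_zero fourier_std_normal by (simp add: scaleR_conv_of_real)
  also have "?c * sqrt (2 * pi) * exp (- (h / d)\<^sup>2 / 2) = std_normal_density (h / d) / d"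
  proof -
    have "?c * sqrt (2 * pi) = (1 / sqrt (2 * pi)) / d"
      using d real_sqrt_mult_self[of "2 * pi"] by (simp add: field_simps del: real_sqrt_mult_self)
    then show ?thesis unfolding std_normal_density_def by simp
  qed
  finally show ?thesis .
qed

text \<open>A Gaussian is put in the place of the potential, so the lemmas about \<open>pot\<close>
  apply to damped Fourier inversion. By Fubini the damping becomes an average of
  \<open>\<phi>\<close> with a normal density of standard deviation \<open>d\<close>.\<close>

lemma pot_gauss:
  assumes d: "d > 0" and \<phi>: "integrable lborel \<phi>"
  shows "pot (gauss d) \<phi> k = (\<integral>s. \<phi> (k + d * s) * complex_of_real (std_normal_density s) \<partial>lborel)"
proof -
  let ?u = "\<lambda>x. cis (2 * pi * x * (- k)) * complex_of_real (gauss d x)"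
  have u: "integrable lborel ?u"
    using integrable_gauss[OF d] by (intro integrable_unimodular_mult) auto
  have "pot (gauss d) \<phi> k = (\<integral>x. ?u x * (\<integral>k'. cis (2 * pi * k' * x) * \<phi> k' \<partial>lborel) \<partial>lborel)"
    unfolding pot_def four_inv_def by (simp add: mult.assoc)
  also have "\<dots> = (\<integral>k'. \<phi> k' * (\<integral>x. cis (2 * pi * k' * x) * ?u x \<partial>lborel) \<partial>lborel)"
    by (rule Fubini_bounded_kernel[OF u \<phi>]) auto
  also have "(\<integral>x. cis (2 * pi * k' * x) * ?u x \<partial>lborel) = four_inv (\<lambda>x. complex_of_real (gauss d x)) (k' - k)" for k'
  proof -
    have "cis (2 * pi * k' * x) * cis (2 * pi * x * (- k)) = cis (2 * pi * x * (k' - k))" for x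
      unfolding cis_mult by (simp add: algebra_simps)
    then show ?thesis unfolding four_inv_def mult.assoc[symmetric] by simp
  qed
  then have "(\<integral>k'. \<phi> k' * (\<integral>x. cis (2 * pi * k' * x) * ?u x \<partial>lborel) \<partial>lborel)
      = (\<integral>k'. \<phi> k' * complex_of_real (std_normal_density ((k' - k) / d) / d) \<partial>lborel)"
    by (simp add: four_inv_gauss[OF d])
  \<comment> \<open>The substitution \<open>k' = k + d * s\<close>; its Jacobian cancels the factor
    \<open>1 / d\<close> of the density.\<close>
  also have "\<dots> = \<bar>d\<bar> *\<^sub>R (\<integral>s. \<phi> (k + d * s) * complex_of_real (std_normal_density (((k + d * s) - k) / d) / d) \<partial>lborel)"
    using d by (intro lborel_integral_real_affine) simp
  also have "\<dots> = (\<integral>s. \<phi> (k + d * s) * complex_of_real (std_normal_density s) \<partial>lborel)"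
    using d by (simp add: scaleR_conv_of_real)
  finally show ?thesis .
qed

lemma nn_integral_std_normal: "(\<integral>\<^sup>+ s. ennreal (std_normal_density s) \<partial>lborel) = 1"
  by (subst nn_integral_eq_integral) (auto simp: integrable_std_normal)

text \<open>In Fourier space the damped energy is an average over \<open>s\<close> of the pairings
  of \<open>\<phi>\<close> with its translates by \<open>d * s\<close>. Each product is at most half
  the sum of two squares, and translation invariance gives both squares the same integral.\<close>

lemma pot_energy_gauss_le:
  assumes d: "d > 0" and \<phi>: "integrable lborel \<phi>" and sq: "integrable lborel (\<lambda>k. (cmod (\<phi> k))\<^sup>2)"
  shows "pot_energy (gauss d) \<phi> \<le> (\<integral>k. (cmod (\<phi> k))\<^sup>2 \<partial>lborel)"
proof -
  have [measurable]: "\<phi> \<in> borel_measurable borel"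
    using borel_measurable_integrable[OF \<phi>] by simp
  have G: "integrable lborel (gauss d)" by (rule integrable_gauss[OF d])
  let ?n = "\<lambda>s. ennreal (std_normal_density s)" and ?N = "\<integral>\<^sup>+ k. ennreal ((cmod (\<phi> k))\<^sup>2) \<partial>lborel"
  have [measurable]: "pot (gauss d) \<phi> \<in> borel_measurable borel"
    by (rule borel_measurable_continuous_onI[OF continuous_pot[OF G \<phi>]])
  have "complex_of_real (pot_energy (gauss d) \<phi>) = (\<integral>x. complex_of_real (gauss d x) * four_inv \<phi> x * cnj (four_inv \<phi> x) \<partial>lborel)"
    unfolding pot_energy_def integral_complex_of_real[symmetric] of_real_mult complex_norm_square mult.assoc ..
  also have "\<dots> = (\<integral>k. pot (gauss d) \<phi> k * cnj (\<phi> k) \<partial>lborel)"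
    by (rule pot_form[OF G \<phi> \<phi>])
  finally have eq: "complex_of_real (pot_energy (gauss d) \<phi>) = (\<integral>k. pot (gauss d) \<phi> k * cnj (\<phi> k) \<partial>lborel)" .
  have i: "integrable lborel (\<lambda>k. pot (gauss d) \<phi> k * cnj (\<phi> k))"
  proof (rule Bochner_Integration.integrable_bound)
    let ?C = "(\<integral>x. \<bar>gauss d x\<bar> \<partial>lborel) * (\<integral>k. cmod (\<phi> k) \<partial>lborel)"
    show "integrable lborel (\<lambda>k. ?C * cmod (\<phi> k))" using \<phi> by simp
    show "AE k in lborel. norm (pot (gauss d) \<phi> k * cnj (\<phi> k)) \<le> norm (?C * cmod (\<phi> k))"
      using pot_bound[OF G \<phi>] by (auto simp: norm_mult abs_mult intro!: mult_right_mono)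
  qed measurable
  have pw: "ennreal (cmod (pot (gauss d) \<phi> k * cnj (\<phi> k)))
      \<le> (\<integral>\<^sup>+ s. ennreal ((cmod (\<phi> (k + d * s)))\<^sup>2 / 2 + (cmod (\<phi> k))\<^sup>2 / 2) * ?n s \<partial>lborel)" for k
  proof -
    let ?h = "\<lambda>s. cnj (\<phi> k) * (\<phi> (k + d * s) * complex_of_real (std_normal_density s))"
    have "pot (gauss d) \<phi> k * cnj (\<phi> k) = (\<integral>s. ?h s \<partial>lborel)"
      unfolding pot_gauss[OF d \<phi>] integral_mult_right_zero by (rule mult.commute)
    then have "ennreal (cmod (pot (gauss d) \<phi> k * cnj (\<phi> k))) = ennreal (cmod (\<integral>s. ?h s \<partial>lborel))"
      by (rule arg_cong)
    also have "ennreal (cmod (\<integral>s. ?h s \<partial>lborel)) \<le> (\<integral>\<^sup>+ s. ennreal (cmod (?h s)) \<partial>lborel)"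
    proof (cases "integrable lborel ?h")
      case True then show ?thesis by (rule integral_norm_bound_ennreal)
    next
      \<comment> \<open>The Bochner integral of a function that is not integrable is 0 by
        convention, so the bound holds here too.\<close>
      case False
      then have "(\<integral>s. ?h s \<partial>lborel) = 0"
        by (rule Bochner_Integration.not_integrable_integral_eq)
      then show ?thesis by (simp only: norm_zero ennreal_0 zero_le)
    qed
    also have "\<dots> \<le> (\<integral>\<^sup>+ s. ennreal ((cmod (\<phi> (k + d * s)))\<^sup>2 / 2 + (cmod (\<phi> k))\<^sup>2 / 2) * ?n s \<partial>lborel)"
    proof (rule nn_integral_mono)
      fix s
      have "cmod (\<phi> k) * cmod (\<phi> (k + d * s)) \<le> (cmod (\<phi> (k + d * s)))\<^sup>2 / 2 + (cmod (\<phi> k))\<^sup>2 / 2"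
        using sum_squares_bound[of "cmod (\<phi> k)" "cmod (\<phi> (k + d * s))"] by simp
      from mult_right_mono[OF this normal_density_nonneg]
      have "cmod (?h s) \<le> ((cmod (\<phi> (k + d * s)))\<^sup>2 / 2 + (cmod (\<phi> k))\<^sup>2 / 2) * std_normal_density s"
        by (simp only: norm_mult complex_mod_cnj norm_of_real abs_of_nonneg[OF normal_density_nonneg] mult.assoc)
      then show "ennreal (cmod (?h s)) \<le> ennreal ((cmod (\<phi> (k + d * s)))\<^sup>2 / 2 + (cmod (\<phi> k))\<^sup>2 / 2) * ?n s"
        by (subst ennreal_mult[symmetric]) (auto intro: ennreal_leI)
    qed
    finally show ?thesis .
  qed
  have inner: "(\<integral>\<^sup>+ k. ennreal ((cmod (\<phi> (k + d * s)))\<^sup>2 / 2 + (cmod (\<phi> k))\<^sup>2 / 2) \<partial>lborel) = ?N" for s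
  proof -
    let ?f = "\<lambda>k. (cmod (\<phi> k))\<^sup>2"
    have shift: "integrable lborel (\<lambda>k. ?f (k + d * s))"
      using lborel_integrable_real_affine[OF sq, of 1 "d * s"] by (simp only: mult_1 add.commute)
    have "(\<integral>k. ?f (k + d * s) \<partial>lborel) = (\<integral>k. ?f k \<partial>lborel)"
      using lborel_integral_real_affine[of 1 ?f "d * s"] by (simp add: add.commute)
    then have "(\<integral>k. ?f (k + d * s) / 2 + ?f k / 2 \<partial>lborel) = (\<integral>k. ?f k \<partial>lborel)"
      using shift sq by simp
    moreover have "(\<integral>\<^sup>+ k. ennreal (?f (k + d * s) / 2 + ?f k / 2) \<partial>lborel)
        = ennreal (\<integral>k. ?f (k + d * s) / 2 + ?f k / 2 \<partial>lborel)"
      using shift sq by (intro nn_integral_eq_integral) auto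
    moreover have "?N = ennreal (\<integral>k. ?f k \<partial>lborel)"
      by (rule nn_integral_eq_integral[OF sq]) simp
    ultimately show ?thesis by (simp only:)
  qed
  have "ennreal (pot_energy (gauss d) \<phi>) \<le> ennreal (cmod (\<integral>k. pot (gauss d) \<phi> k * cnj (\<phi> k) \<partial>lborel))"
    unfolding eq[symmetric] by (simp add: ennreal_leI)
  also have "\<dots> \<le> (\<integral>\<^sup>+ k. ennreal (cmod (pot (gauss d) \<phi> k * cnj (\<phi> k))) \<partial>lborel)"
    by (rule integral_norm_bound_ennreal[OF i])
  also have "\<dots> \<le> (\<integral>\<^sup>+ k. \<integral>\<^sup>+ s. ennreal ((cmod (\<phi> (k + d * s)))\<^sup>2 / 2 + (cmod (\<phi> k))\<^sup>2 / 2) * ?n s \<partial>lborel \<partial>lborel)"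
    by (intro nn_integral_mono pw)
  \<comment> \<open>Tonelli's theorem puts the \<open>k\<close>-integral inside, where
    \<open>inner\<close> evaluates it independently of \<open>s\<close>.\<close>
  also have "\<dots> = (\<integral>\<^sup>+ s. \<integral>\<^sup>+ k. ennreal ((cmod (\<phi> (k + d * s)))\<^sup>2 / 2 + (cmod (\<phi> k))\<^sup>2 / 2) * ?n s \<partial>lborel \<partial>lborel)"
    by (rule lborel_pair.Fubini'[symmetric]) measurable
  also have "\<dots> = (\<integral>\<^sup>+ s. ?N * ?n s \<partial>lborel)"
    by (intro nn_integral_cong, subst nn_integral_multc) (measurable, simp only: inner)
  also have "\<dots> = ?N * (\<integral>\<^sup>+ s. ?n s \<partial>lborel)"
    by (rule nn_integral_cmult) measurable
  also have "\<dots> = ?N"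
    unfolding nn_integral_std_normal by (rule mult_1_right)
  also have "\<dots> = ennreal (\<integral>k. (cmod (\<phi> k))\<^sup>2 \<partial>lborel)"
    by (rule nn_integral_eq_integral[OF sq]) simp
  finally show ?thesis
    by (subst (asm) ennreal_le_iff) auto
qed

abbreviation gauss_seq :: "nat \<Rightarrow> real \<Rightarrow> real" where
  "gauss_seq n \<equiv> gauss (inverse (real (Suc n)))"

lemma gauss_seq_tendsto: "(\<lambda>n. gauss_seq n x) \<longlonglongrightarrow> 1"
proof -
  have "(\<lambda>n. gauss_seq n x) \<longlonglongrightarrow> exp (- (2 * pi * 0 * x)\<^sup>2 / 2)"
    unfolding gauss_def by (intro tendsto_intros LIMSEQ_inverse_real_of_nat) simp
  then show ?thesis by simp
qed

lemma gauss_le_1: "gauss d x \<le> 1" and gauss_nonneg: "0 \<le> gauss d x"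
  unfolding gauss_def by simp_all

lemma measurable_gauss [measurable]: "gauss d \<in> borel_measurable borel"
  unfolding gauss_def by measurable

text \<open>Fatou's lemma removes the Gaussian factor: the damped integrals are bounded by the mass
  of \<open>\<phi>\<close> uniformly in \<open>n\<close>, and the factor tends to 1.\<close>

lemma four_inv_square_integrable:
  assumes \<phi>: "integrable lborel \<phi>" and sq: "integrable lborel (\<lambda>k. (cmod (\<phi> k))\<^sup>2)"
  shows "integrable lborel (\<lambda>x. (cmod (four_inv \<phi> x))\<^sup>2)"
proof (rule integrableI_bounded)
  have [measurable]: "\<phi> \<in> borel_measurable borel"
    using borel_measurable_integrable[OF \<phi>] by simp
  have [measurable]: "four_inv \<phi> \<in> borel_measurable borel"
    by (rule four_inv_measurable) measurable
  show "(\<lambda>x. (cmod (four_inv \<phi> x))\<^sup>2) \<in> borel_measurable lborel" by measurable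
  let ?u = "\<lambda>n x. ennreal (gauss_seq n x * (cmod (four_inv \<phi> x))\<^sup>2)"
  have "(\<lambda>n. ?u n x) \<longlonglongrightarrow> ennreal (1 * (cmod (four_inv \<phi> x))\<^sup>2)" for x
    by (intro tendsto_ennrealI tendsto_mult gauss_seq_tendsto tendsto_const)
  then have lim: "liminf (\<lambda>n. ?u n x) = ennreal ((cmod (four_inv \<phi> x))\<^sup>2)" for x
    by (simp add: lim_imp_Liminf)
  have le: "(\<integral>\<^sup>+ x. ?u n x \<partial>lborel) \<le> ennreal (\<integral>k. (cmod (\<phi> k))\<^sup>2 \<partial>lborel)" for n
  proof -
    have d: "inverse (real (Suc n)) > 0" by simp
    have "(\<integral>\<^sup>+ x. ?u n x \<partial>lborel) = ennreal (pot_energy (gauss_seq n) \<phi>)"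
      unfolding pot_energy_def
      by (intro nn_integral_eq_integral pot_energy_integrable integrable_gauss \<phi> AE_I2) (auto simp: gauss_nonneg)
    then show ?thesis using pot_energy_gauss_le[OF d \<phi> sq] by (simp add: ennreal_leI)
  qed
  have "(\<integral>\<^sup>+ x. liminf (\<lambda>n. ?u n x) \<partial>lborel) \<le> liminf (\<lambda>n. \<integral>\<^sup>+ x. ?u n x \<partial>lborel)"
    by (rule nn_integral_liminf) measurable
  also have "\<dots> \<le> ennreal (\<integral>k. (cmod (\<phi> k))\<^sup>2 \<partial>lborel)"
    using le by (intro Liminf_le) (auto intro!: always_eventually)
  finally show "(\<integral>\<^sup>+ x. ennreal (norm ((cmod (four_inv \<phi> x))\<^sup>2)) \<partial>lborel) < \<infinity>"
    unfolding lim by (simp add: order_le_less_trans)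
qed

text \<open>The averages form an approximate identity. Continuity gives convergence under the
  integral, and \<open>M\<close> times the normal density dominates.\<close>

lemma pot_gauss_tendsto:
  assumes \<phi>: "integrable lborel \<phi>" and cont: "continuous_on UNIV \<phi>" and bd: "\<And>k. cmod (\<phi> k) \<le> M"
  shows "(\<lambda>n. pot (gauss_seq n) \<phi> k) \<longlonglongrightarrow> \<phi> k"
    and "cmod (pot (gauss_seq n) \<phi> k) \<le> M"
proof -
  have [measurable]: "\<phi> \<in> borel_measurable borel"
    using borel_measurable_integrable[OF \<phi>] by simp
  let ?n = "\<lambda>s. complex_of_real (std_normal_density s)" and ?d = "\<lambda>n. inverse (real (Suc n))"
  have eq: "pot (gauss_seq n) \<phi> k = (\<integral>s. \<phi> (k + ?d n * s) * ?n s \<partial>lborel)" for n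
    by (rule pot_gauss[OF _ \<phi>]) simp
  have w: "integrable lborel (\<lambda>s. M * std_normal_density s)"
    using integrable_std_normal by simp
  have le: "norm (\<phi> (k + ?d n * s) * ?n s) \<le> M * std_normal_density s" for n s
    using bd by (simp add: norm_mult mult_right_mono normal_density_nonneg)
  have "(\<lambda>n. \<integral>s. \<phi> (k + ?d n * s) * ?n s \<partial>lborel) \<longlonglongrightarrow> (\<integral>s. \<phi> k * ?n s \<partial>lborel)"
  proof (rule integral_dominated_convergence[OF _ _ w])
    show "AE s in lborel. (\<lambda>n. \<phi> (k + ?d n * s) * ?n s) \<longlonglongrightarrow> \<phi> k * ?n s"
    proof (rule AE_I2)
      fix s
      have "isCont \<phi> k"
        using cont continuous_on_eq_continuous_at[OF open_UNIV, of \<phi>] by blast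
      moreover have "(\<lambda>n. k + ?d n * s) \<longlonglongrightarrow> k + 0 * s"
        by (intro tendsto_intros LIMSEQ_inverse_real_of_nat)
      then have "(\<lambda>n. k + ?d n * s) \<longlonglongrightarrow> k" by simp
      ultimately have "(\<lambda>n. \<phi> (k + ?d n * s)) \<longlonglongrightarrow> \<phi> k"
        by (rule isCont_tendsto_compose)
      then show "(\<lambda>n. \<phi> (k + ?d n * s) * ?n s) \<longlonglongrightarrow> \<phi> k * ?n s"
        by (rule tendsto_mult_right)
    qed
    show "AE s in lborel. norm (\<phi> (k + ?d n * s) * ?n s) \<le> M * std_normal_density s" for n
      using le by simp
  qed measurable
  moreover have one: "(\<integral>s. ?n s \<partial>lborel) = 1"
    using fourier_std_normal[of 0] by simp
  ultimately show "(\<lambda>n. pot (gauss_seq n) \<phi> k) \<longlonglongrightarrow> \<phi> k"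
    unfolding eq by simp
  have n1: "(\<integral>s. std_normal_density s \<partial>lborel) = 1"
    using one by (simp only: integral_complex_of_real of_real_eq_1_iff)
  have "norm (\<integral>s. \<phi> (k + ?d n * s) * ?n s \<partial>lborel) \<le> (\<integral>s. norm (\<phi> (k + ?d n * s) * ?n s) \<partial>lborel)"
    by (rule integral_norm_bound)
  also have "\<dots> \<le> (\<integral>s. M * std_normal_density s \<partial>lborel)"
    using order_trans[OF norm_ge_zero le] by (intro integral_mono'[OF w le])
  also have "\<dots> = M"
    by (simp only: integral_mult_right_zero n1 mult_1_right)
  finally show "cmod (pot (gauss_seq n) \<phi> k) \<le> M"
    unfolding eq .
qed

text \<open>The Gaussian-damped pairing has two expressions by \<open>pot_form\<close>. In position
  space it converges because both transforms are square integrable, in Fourier space because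
  \<open>\<phi>\<close> is continuous and bounded; uniqueness of limits equates the results. The
  first function will be the eigenfunction and \<open>g\<close> a general element of the form
  domain.\<close>

lemma Plancherel_continuous:
  assumes \<phi>: "integrable lborel \<phi>" "integrable lborel (\<lambda>k. (cmod (\<phi> k))\<^sup>2)"
    and g: "integrable lborel g" "integrable lborel (\<lambda>k. (cmod (g k))\<^sup>2)"
    and cont: "continuous_on UNIV \<phi>" and bd: "\<And>k. cmod (\<phi> k) \<le> M"
  shows "(\<integral>x. four_inv \<phi> x * cnj (four_inv g x) \<partial>lborel) = (\<integral>k. \<phi> k * cnj (g k) \<partial>lborel)"
proof (rule LIMSEQ_unique)
  have [measurable]: "\<phi> \<in> borel_measurable borel" "g \<in> borel_measurable borel"
      "four_inv \<phi> \<in> borel_measurable borel" "four_inv g \<in> borel_measurable borel"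
    using borel_measurable_integrable[OF \<phi>(1)] borel_measurable_integrable[OF g(1)]
    by (auto intro: four_inv_measurable)
  have G: "integrable lborel (gauss_seq n)" for n
    by (rule integrable_gauss) simp
  have [measurable]: "pot (gauss_seq n) \<phi> \<in> borel_measurable borel" for n
    by (rule borel_measurable_continuous_onI[OF continuous_pot[OF G \<phi>(1)]])
  let ?a = "\<lambda>n. \<integral>x. complex_of_real (gauss_seq n x) * four_inv \<phi> x * cnj (four_inv g x) \<partial>lborel"
  show "?a \<longlonglongrightarrow> (\<integral>x. four_inv \<phi> x * cnj (four_inv g x) \<partial>lborel)"
  proof (rule integral_dominated_convergence)
    show "integrable lborel (\<lambda>x. (cmod (four_inv \<phi> x))\<^sup>2 + (cmod (four_inv g x))\<^sup>2)"
      using four_inv_square_integrable[OF \<phi>] four_inv_square_integrable[OF g] by simp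
    show "AE x in lborel. (\<lambda>n. complex_of_real (gauss_seq n x) * four_inv \<phi> x * cnj (four_inv g x))
        \<longlonglongrightarrow> four_inv \<phi> x * cnj (four_inv g x)"
    proof (rule AE_I2)
      fix x
      have "(\<lambda>n. complex_of_real (gauss_seq n x) * four_inv \<phi> x * cnj (four_inv g x))
        \<longlonglongrightarrow> complex_of_real 1 * four_inv \<phi> x * cnj (four_inv g x)"
        by (intro tendsto_mult tendsto_of_real gauss_seq_tendsto tendsto_const)
      then show "(\<lambda>n. complex_of_real (gauss_seq n x) * four_inv \<phi> x * cnj (four_inv g x))
        \<longlonglongrightarrow> four_inv \<phi> x * cnj (four_inv g x)" by simp
    qed
    show "AE x in lborel. norm (complex_of_real (gauss_seq n x) * four_inv \<phi> x * cnj (four_inv g x))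
        \<le> (cmod (four_inv \<phi> x))\<^sup>2 + (cmod (four_inv g x))\<^sup>2" for n
    proof (rule AE_I2)
      fix x
      let ?p = "cmod (four_inv \<phi> x)" and ?q = "cmod (four_inv g x)"
      have "gauss_seq n x * (?p * ?q) \<le> 1 * (?p * ?q)"
        by (intro mult_right_mono gauss_le_1) simp
      also have "\<dots> \<le> ?p\<^sup>2 + ?q\<^sup>2"
        using sum_squares_bound[of ?p ?q] mult_nonneg_nonneg[of ?p ?q] norm_ge_zero[of "four_inv \<phi> x"] norm_ge_zero[of "four_inv g x"]
        by linarith
      finally show "norm (complex_of_real (gauss_seq n x) * four_inv \<phi> x * cnj (four_inv g x)) \<le> ?p\<^sup>2 + ?q\<^sup>2"
        by (simp add: norm_mult gauss_nonneg mult.assoc)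
    qed
  qed measurable
  have "(\<lambda>n. \<integral>k. pot (gauss_seq n) \<phi> k * cnj (g k) \<partial>lborel) \<longlonglongrightarrow> (\<integral>k. \<phi> k * cnj (g k) \<partial>lborel)"
  proof (rule integral_dominated_convergence)
    show "integrable lborel (\<lambda>k. M * cmod (g k))" using g by simp
    show "AE k in lborel. (\<lambda>n. pot (gauss_seq n) \<phi> k * cnj (g k)) \<longlonglongrightarrow> \<phi> k * cnj (g k)"
      by (intro AE_I2 tendsto_mult tendsto_const pot_gauss_tendsto(1)[OF \<phi>(1) cont bd])
    show "AE k in lborel. norm (pot (gauss_seq n) \<phi> k * cnj (g k)) \<le> M * cmod (g k)" for n
      using pot_gauss_tendsto(2)[OF \<phi>(1) cont bd] by (auto simp: norm_mult intro!: mult_right_mono)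
  qed measurable
  then show "?a \<longlonglongrightarrow> (\<integral>k. \<phi> k * cnj (g k) \<partial>lborel)"
    by (simp only: pot_form[OF G \<phi>(1) g(1)])
qed

section \<open>The bottom of the spectrum\<close>

definition energy :: "real \<Rightarrow> (real \<Rightarrow> real) \<Rightarrow> (real \<Rightarrow> complex) \<Rightarrow> real" where
  "energy b V \<phi> = (\<integral>k. wt b k * (cmod (\<phi> k))\<^sup>2 \<partial>lborel) - pot_energy V \<phi>"

abbreviation mass :: "(real \<Rightarrow> complex) \<Rightarrow> real" where
  "mass \<phi> \<equiv> \<integral>k. (cmod (\<phi> k))\<^sup>2 \<partial>lborel"

lemma pot_energy_scale: "pot_energy V (\<lambda>k. c * \<phi> k) = (cmod c)\<^sup>2 * pot_energy V \<phi>"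
proof -
  have "V x * (cmod (four_inv (\<lambda>k. c * \<phi> k) x))\<^sup>2 = (cmod c)\<^sup>2 * (V x * (cmod (four_inv \<phi> x))\<^sup>2)" for x
    unfolding four_inv_scale norm_mult power_mult_distrib by (rule mult.left_commute)
  then show ?thesis unfolding pot_energy_def by (simp only: integral_mult_right_zero)
qed

lemma energy_scale: "energy b V (\<lambda>k. c * \<phi> k) = (cmod c)\<^sup>2 * energy b V \<phi>"
proof -
  have "wt b k * (cmod (c * \<phi> k))\<^sup>2 = (cmod c)\<^sup>2 * (wt b k * (cmod (\<phi> k))\<^sup>2)" for k
    by (simp add: norm_mult power_mult_distrib)
  then show ?thesis
    unfolding energy_def pot_energy_scale by (simp only: integral_mult_right_zero right_diff_distrib)
qed

lemma mass_scale: "mass (\<lambda>k. c * \<phi> k) = (cmod c)\<^sup>2 * mass \<phi>"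
  by (simp add: norm_mult power_mult_distrib)

text \<open>Adding a constant \<open>n\<close> to the weight makes the integral of its inverse as
  small as desired, so Cauchy-Schwarz bounds the potential with relative form bound 1/2. This gives
  the lower bound for the energy and the kinetic bound along minimising sequences.\<close>

lemma potential_form_bounded:
  assumes b: "b > 0" and V: "integrable lborel V"
  shows "\<exists>s\<ge>0. \<forall>\<phi>\<in>form_dom b.
    pot_energy V \<phi> \<le> ((\<integral>k. wt b k * (cmod (\<phi> k))\<^sup>2 \<partial>lborel) + s * mass \<phi>) / 2"
proof -
  define om where "om n k = real n + wt b k" for n :: nat and k
  have pos: "om n k > 0" for n k
    using wt_ge_2[of b k] by (simp add: om_def)
  have [measurable]: "om n \<in> borel_measurable borel" for n
    unfolding om_def by measurable
  have i: "integrable lborel (\<lambda>k. 1 / om n k)" for n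
    by (rule integrable_inverse_wt[OF b zero_less_one]) (auto simp: om_def)
  let ?J = "\<lambda>n. \<integral>k. 1 / om n k \<partial>lborel" and ?v = "\<integral>x. \<bar>V x\<bar> \<partial>lborel"
  \<comment> \<open>Dominated convergence with majorant
    \<open>1 / om 0 k = 1 / wt b k\<close>.\<close>
  have "?J \<longlonglongrightarrow> (\<integral>k. 0 \<partial>(lborel :: real measure))"
  proof (rule integral_dominated_convergence[OF _ _ i[of 0]])
    show "AE k in lborel. (\<lambda>n. 1 / om n k) \<longlonglongrightarrow> 0"
    proof (rule AE_I2)
      fix k
      have "filterlim (\<lambda>n. wt b k + real n) at_top sequentially"
        by (rule filterlim_tendsto_add_at_top[OF tendsto_const filterlim_real_sequentially])
      then show "(\<lambda>n. 1 / om n k) \<longlonglongrightarrow> 0"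
        unfolding om_def add.commute[of "real _"]
        by (intro tendsto_divide_0[OF tendsto_const] filterlim_at_top_imp_at_infinity)
    qed
    show "AE k in lborel. norm (1 / om n k) \<le> 1 / om 0 k" for n
      using pos[of n] pos[of 0] by (auto simp: om_def abs_of_pos intro!: divide_left_mono)
  qed measurable
  then have "(\<lambda>n. ?v * ?J n) \<longlonglongrightarrow> ?v * 0"
    by (intro tendsto_mult_left) simp
  then have "\<forall>\<^sub>F n in sequentially. ?v * ?J n < 1 / 2"
    by (rule order_tendstoD) simp
  then obtain n where n: "?v * ?J n < 1 / 2"
    unfolding eventually_sequentially by blast
  show ?thesis
  proof (intro exI conjI ballI)
    fix \<phi> assume \<phi>: "\<phi> \<in> form_dom b"
    have eq: "om n k * (cmod (\<phi> k))\<^sup>2 = wt b k * (cmod (\<phi> k))\<^sup>2 + real n * (cmod (\<phi> k))\<^sup>2" for k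
      by (simp add: om_def algebra_simps)
    have iX: "integrable lborel (\<lambda>k. om n k * (cmod (\<phi> k))\<^sup>2)"
      unfolding eq using form_dom_wt[OF \<phi>] form_dom_square[OF \<phi>] by simp
    let ?X = "\<integral>k. om n k * (cmod (\<phi> k))\<^sup>2 \<partial>lborel"
    have X0: "0 \<le> ?X"
      using pos by (intro integral_nonneg_AE AE_I2 mult_nonneg_nonneg) (auto simp: less_imp_le)
    have "pot_energy V \<phi> \<le> ?v * (\<integral>k. cmod (\<phi> k) \<partial>lborel)\<^sup>2"
      by (rule pot_energy_le[OF V form_dom_integrable[OF b \<phi>]])
    also have "\<dots> \<le> ?v * (?J n * ?X)"
      using weighted_Cauchy_Schwarz(2)[OF pos i iX form_dom_measurable[OF \<phi>]]
      by (intro mult_left_mono) auto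
    also have "\<dots> \<le> 1 / 2 * ?X"
      using mult_right_mono[OF less_imp_le[OF n] X0] by (simp only: mult.assoc)
    also have "?X = (\<integral>k. wt b k * (cmod (\<phi> k))\<^sup>2 \<partial>lborel) + real n * mass \<phi>"
      unfolding eq using form_dom_wt[OF \<phi>] form_dom_square[OF \<phi>]
      by (simp only: Bochner_Integration.integral_add integrable_mult_right integral_mult_right_zero)
    finally show "pot_energy V \<phi> \<le> ((\<integral>k. wt b k * (cmod (\<phi> k))\<^sup>2 \<partial>lborel) + real n * mass \<phi>) / 2"
      by simp
  qed simp
qed

lemma kinetic_quotient_tendsto_0:
  "(\<lambda>n. (wt b (inverse (real (Suc n))) - 2) / (2 * inverse (real (Suc n)))) \<longlonglongrightarrow> 0"
proof -
  let ?d = "\<lambda>n. inverse (real (Suc n))"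
  \<comment> \<open>The quotient is a difference quotient of \<open>cosh\<close> at 0, where the
    derivative vanishes. Its denominator \<open>2 * d\<close> comes from the mass
    \<open>1 / (2 * d)\<close> of the trial states.\<close>
  have "((\<lambda>h. cosh (2 * pi * b * h)) has_real_derivative sinh (2 * pi * b * 0) * (2 * pi * b)) (at 0)"
    by (auto intro!: derivative_eq_intros)
  then have "((\<lambda>h. (cosh (2 * pi * b * h) - 1) / h) \<longlongrightarrow> 0) (at 0)"
    by (simp add: DERIV_def)
  moreover have "filterlim ?d (at 0) sequentially"
    using LIMSEQ_inverse_real_of_nat by (simp add: filterlim_at)
  ultimately have "(\<lambda>n. (cosh (2 * pi * b * ?d n) - 1) / ?d n) \<longlonglongrightarrow> 0"
    by (rule filterlim_compose)
  moreover have "(wt b d - 2) / (2 * d) = (cosh (2 * pi * b * d) - 1) / d" if "d > 0" for d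
    using that by (simp add: field_simps)
  ultimately show ?thesis by simp
qed

text \<open>States concentrated near frequency 0 look constant in position space: their potential
  energy tends to the integral of V, which is positive, while their kinetic excess over 2 tends to
  0.\<close>

lemma trial_function:
  assumes b: "b > 0" and V: "integrable lborel V" and V0: "AE x in lborel. V x \<ge> 0"
    and nz: "\<not> (AE x in lborel. V x = 0)"
  obtains \<phi> where "\<phi> \<in> form_dom b" "mass \<phi> > 0" "energy b V \<phi> < 2 * mass \<phi>"
proof -
  let ?d = "\<lambda>n. inverse (real (Suc n))"
  \<comment> \<open>The height makes the \<open>L\<^sup>1\<close> norm equal to 1, so
    \<open>four_inv (\<phi> n)\<close> is 1 at the origin and bounded by 1;
    \<open>\<bar>V x\<bar>\<close> then dominates the potential integrands.\<close>
  define \<phi> where "\<phi> n k = complex_of_real (indicator {- ?d n .. ?d n} k / (2 * ?d n))" for n k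
  have [measurable]: "V \<in> borel_measurable borel"
    using borel_measurable_integrable[OF V] by simp
  have [measurable]: "\<phi> n \<in> borel_measurable borel" for n
    unfolding \<phi>_def by measurable
  have d: "?d n > 0" for n by simp
  have cm: "cmod (\<phi> n k) = indicator {- ?d n .. ?d n} k / (2 * ?d n)" for n k
    unfolding \<phi>_def norm_of_real by (simp add: indicator_def)
  have cm2: "(cmod (\<phi> n k))\<^sup>2 = indicator {- ?d n .. ?d n} k / (2 * ?d n)\<^sup>2" for n k
    unfolding cm by (simp add: indicator_def power_divide)
  have ind: "integrable lborel (\<lambda>k. indicator {- ?d n .. ?d n} k :: real)" for n
    by (rule integrable_real_indicator) (auto simp: emeasure_lborel_Icc_eq)
  have ind_int: "(\<integral>k. indicator {- ?d n .. ?d n} k \<partial>lborel) = 2 * ?d n" for n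
    by simp
  have L1: "(\<integral>k. cmod (\<phi> n k) \<partial>lborel) = 1" for n
    unfolding cm integral_divide_zero ind_int using d[of n] by simp
  have sq: "integrable lborel (\<lambda>k. (cmod (\<phi> n k))\<^sup>2)" for n
    unfolding cm2 using ind by simp
  have mass: "mass (\<phi> n) = 1 / (2 * ?d n)" for n
    unfolding cm2 integral_divide_zero ind_int using d[of n] by (simp add: power2_eq_square)
  have wle: "wt b k * (cmod (\<phi> n k))\<^sup>2 \<le> wt b (?d n) * (cmod (\<phi> n k))\<^sup>2" for n k
  proof (cases "k \<in> {- ?d n .. ?d n}")
    case True
    then have "\<bar>k\<bar> \<le> ?d n" by auto
    then have "\<bar>2 * pi * b * k\<bar> \<le> 2 * pi * b * ?d n"
      using b unfolding abs_mult by (intro mult_mono) auto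
    then have "cosh \<bar>2 * pi * b * k\<bar> \<le> cosh (2 * pi * b * ?d n)"
      using b by (subst cosh_real_nonneg_le_iff) auto
    then show ?thesis by (intro mult_right_mono) auto
  next
    case False then show ?thesis by (simp add: cm2)
  qed
  have iw: "integrable lborel (\<lambda>k. wt b k * (cmod (\<phi> n k))\<^sup>2)" for n
  proof (rule Bochner_Integration.integrable_bound)
    show "integrable lborel (\<lambda>k. wt b (?d n) * (cmod (\<phi> n k))\<^sup>2)"
      using sq by (rule integrable_mult_right)
    show "AE k in lborel. norm (wt b k * (cmod (\<phi> n k))\<^sup>2) \<le> norm (wt b (?d n) * (cmod (\<phi> n k))\<^sup>2)"
      using wle by (auto simp: abs_mult)
  qed measurable
  have dom: "\<phi> n \<in> form_dom b" for n
    using iw by (simp only: form_dom_iff) simp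
  have int: "integrable lborel (\<phi> n)" for n
    by (rule form_dom_integrable[OF b dom])
  have "(\<integral>k. wt b k * (cmod (\<phi> n k))\<^sup>2 \<partial>lborel) \<le> (\<integral>k. wt b (?d n) * (cmod (\<phi> n k))\<^sup>2 \<partial>lborel)" for n
    by (rule integral_mono[OF iw integrable_mult_right[OF sq] wle])
  then have kin: "(\<integral>k. wt b k * (cmod (\<phi> n k))\<^sup>2 \<partial>lborel) \<le> wt b (?d n) * mass (\<phi> n)" for n
    by (simp only: integral_mult_right_zero)
  have four0: "four_inv (\<phi> n) 0 = 1" for n
  proof -
    have "four_inv (\<phi> n) 0 = (\<integral>k. complex_of_real (cmod (\<phi> n k)) \<partial>lborel)"
      unfolding four_inv_def cm by (simp add: \<phi>_def)
    then show ?thesis by (simp add: L1)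
  qed
  \<comment> \<open>On the support of \<open>\<phi> n\<close> the frequency is at most
    \<open>?d n\<close>, so the phase differs from 1 by at most
    \<open>2 * pi * \<bar>x\<bar> * ?d n\<close>.\<close>
  have four1: "cmod (four_inv (\<phi> n) x - 1) \<le> (2 * pi * \<bar>x\<bar>) * ?d n" for n x
  proof -
    have "cmod (four_inv (\<phi> n) x - four_inv (\<phi> n) 0)
        \<le> (\<integral>k. cmod (\<phi> n k) * cmod (cis (2 * pi * k * (x - 0)) - 1) \<partial>lborel)"
      by (rule four_inv_oscillation[OF int])
    also have "\<dots> \<le> (\<integral>k. cmod (\<phi> n k) * (2 * pi * \<bar>x\<bar> * ?d n) \<partial>lborel)"
    proof (rule integral_mono')
      show "integrable lborel (\<lambda>k. cmod (\<phi> n k) * (2 * pi * \<bar>x\<bar> * ?d n))"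
        using int by simp
      show "cmod (\<phi> n k) * cmod (cis (2 * pi * k * (x - 0)) - 1) \<le> cmod (\<phi> n k) * (2 * pi * \<bar>x\<bar> * ?d n)" for k
      proof (cases "k \<in> {- ?d n .. ?d n}")
        case True
        then have "\<bar>k\<bar> \<le> ?d n" by auto
        have "cmod (cis (2 * pi * k * (x - 0)) - 1) \<le> \<bar>2 * pi * k * (x - 0)\<bar>"
          by (rule norm_cis_diff_one_le)
        also have "\<dots> = 2 * pi * \<bar>x\<bar> * \<bar>k\<bar>" by (simp add: abs_mult)
        also have "\<dots> \<le> 2 * pi * \<bar>x\<bar> * ?d n"
          using \<open>\<bar>k\<bar> \<le> ?d n\<close> by (intro mult_left_mono) auto
        finally show ?thesis by (rule mult_left_mono) simp
      next
        case False then show ?thesis by (simp add: cm)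
      qed
    qed auto
    also have "\<dots> = 2 * pi * \<bar>x\<bar> * ?d n" by (simp add: L1 del: inverse_eq_divide)
    finally show ?thesis by (simp only: four0)
  qed
  have "(\<lambda>n. (2 * pi * \<bar>x\<bar>) * ?d n) \<longlonglongrightarrow> (2 * pi * \<bar>x\<bar>) * 0" for x :: real
    by (intro tendsto_mult_left LIMSEQ_inverse_real_of_nat)
  then have bound0: "(\<lambda>n. (2 * pi * \<bar>x\<bar>) * ?d n) \<longlonglongrightarrow> 0" for x :: real
    by (simp only: mult_zero_right)
  have "(\<lambda>n. four_inv (\<phi> n) x - 1) \<longlonglongrightarrow> 0" for x
    by (rule Lim_null_comparison[OF _ bound0[of x]]) (intro always_eventually allI four1)
  then have four: "(\<lambda>n. four_inv (\<phi> n) x) \<longlonglongrightarrow> 1" for x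
    by (simp add: LIM_zero_iff)
  have [measurable]: "four_inv (\<phi> n) \<in> borel_measurable borel" for n
    by (rule four_inv_measurable) measurable
  have "(\<lambda>n. pot_energy V (\<phi> n)) \<longlonglongrightarrow> (\<integral>x. V x * (cmod 1)\<^sup>2 \<partial>lborel)"
    unfolding pot_energy_def
  proof (rule integral_dominated_convergence)
    show "AE x in lborel. (\<lambda>n. V x * (cmod (four_inv (\<phi> n) x))\<^sup>2) \<longlonglongrightarrow> V x * (cmod 1)\<^sup>2"
      by (intro AE_I2 tendsto_intros four)
    show "AE x in lborel. norm (V x * (cmod (four_inv (\<phi> n) x))\<^sup>2) \<le> \<bar>V x\<bar>" for n
      using four_inv_bound[of "\<phi> n"] by (auto simp: L1 abs_mult intro!: mult_left_le power_le_one)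
    show "integrable lborel (\<lambda>x. \<bar>V x\<bar>)" using V by simp
  qed measurable
  then have "(\<lambda>n. (wt b (?d n) - 2) / (2 * ?d n) - pot_energy V (\<phi> n)) \<longlonglongrightarrow> 0 - (\<integral>x. V x \<partial>lborel)"
    by (intro tendsto_diff kinetic_quotient_tendsto_0) simp
  moreover have "(\<integral>x. V x \<partial>lborel) > 0"
  proof -
    have "(\<integral>x. V x \<partial>lborel) \<noteq> 0"
      using integral_nonneg_eq_0_iff_AE[OF V V0] nz by simp
    then show ?thesis using integral_nonneg_AE[OF V0] by simp
  qed
  ultimately have "\<forall>\<^sub>F n in sequentially. (wt b (?d n) - 2) / (2 * ?d n) - pot_energy V (\<phi> n) < 0"
    by (intro order_tendstoD) auto
  then obtain n where n: "(wt b (?d n) - 2) / (2 * ?d n) < pot_energy V (\<phi> n)"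
    unfolding eventually_sequentially by auto
  show thesis
  proof (rule that[OF dom])
    show "0 < mass (\<phi> n)" unfolding mass using d[of n] by simp
    have "(wt b (?d n) - 2) * mass (\<phi> n) < pot_energy V (\<phi> n)"
      using n unfolding mass by simp
    then show "energy b V (\<phi> n) < 2 * mass (\<phi> n)"
      unfolding energy_def using kin[of n] by (simp only: left_diff_distrib)
  qed
qed

text \<open>The witness is the infimum of the energy over normalised elements: the form bound keeps
  it finite and the trial function puts it below 2. The last clause supplies minimising
  sequences.\<close>

lemma spectral_bottom:
  assumes b: "b > 0" and V: "integrable lborel V" and V0: "AE x in lborel. V x \<ge> 0"
    and nz: "\<not> (AE x in lborel. V x = 0)"
  obtains lam where "lam < 2"
    "\<And>\<phi>. \<phi> \<in> form_dom b \<Longrightarrow> lam * mass \<phi> \<le> energy b V \<phi>"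
    "\<And>e. e > 0 \<Longrightarrow> \<exists>\<phi>\<in>form_dom b. mass \<phi> = 1 \<and> energy b V \<phi> < lam + e"
proof -
  define S where "S = energy b V ` {\<phi> \<in> form_dom b. mass \<phi> = 1}"
  obtain s where s: "s \<ge> 0" and
    pe: "\<And>\<phi>. \<phi> \<in> form_dom b \<Longrightarrow> pot_energy V \<phi> \<le> ((\<integral>k. wt b k * (cmod (\<phi> k))\<^sup>2 \<partial>lborel) + s * mass \<phi>) / 2"
    using potential_form_bounded[OF b V] by blast
  have kin0: "0 \<le> (\<integral>k. wt b k * (cmod (\<phi> k))\<^sup>2 \<partial>lborel)" for \<phi>
    by (intro integral_nonneg_AE AE_I2) simp
  \<comment> \<open>Subtracting at most half of the kinetic energy plus
    \<open>s * mass \<phi> / 2\<close> leaves at least half of the kinetic energy, which is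
    nonnegative, minus that term.\<close>
  have low: "- (s * mass \<phi> / 2) \<le> energy b V \<phi>" if "\<phi> \<in> form_dom b" for \<phi>
    using pe[OF that] kin0[of \<phi>] unfolding energy_def by argo
  have normal: "energy b V \<phi> / mass \<phi> \<in> S" if \<phi>: "\<phi> \<in> form_dom b" and m: "mass \<phi> > 0" for \<phi>
  proof -
    let ?c = "complex_of_real (1 / sqrt (mass \<phi>))"
    have c: "(cmod ?c)\<^sup>2 = 1 / mass \<phi>"
      using m by (simp only: norm_of_real) (simp add: power_divide)
    have "energy b V (\<lambda>k. ?c * \<phi> k) \<in> S"
      unfolding S_def using m by (intro imageI CollectI conjI form_dom_scale[OF \<phi>]) (simp only: mass_scale c, simp)
    then show ?thesis by (simp only: energy_scale c) simp
  qed
  obtain t where t: "t \<in> form_dom b" "mass t > 0" "energy b V t < 2 * mass t"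
    by (rule trial_function[OF assms])
  have bdd: "bdd_below S"
  proof (rule bdd_belowI)
    fix x assume "x \<in> S"
    then obtain \<phi> where \<phi>: "\<phi> \<in> form_dom b" "mass \<phi> = 1" "x = energy b V \<phi>"
      by (auto simp: S_def)
    show "- (s * 1 / 2) \<le> x" using low[OF \<phi>(1)] unfolding \<phi>(2,3) .
  qed
  have ne: "S \<noteq> {}" using normal[OF t(1,2)] by auto
  show thesis
  proof (rule that[of "Inf S"])
    have "energy b V t / mass t < 2" using t by (simp add: field_simps)
    then show "Inf S < 2"
      using cInf_lower[OF normal[OF t(1,2)] bdd] by linarith
    show "Inf S * mass \<phi> \<le> energy b V \<phi>" if \<phi>: "\<phi> \<in> form_dom b" for \<phi>
    proof (cases "mass \<phi> > 0")
      case True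
      then show ?thesis
        using cInf_lower[OF normal[OF \<phi> True] bdd] by (simp add: field_simps)
    next
      \<comment> \<open>An element of mass 0 cannot be normalised; for it \<open>low\<close> gives
        nonnegative energy directly.\<close>
      case False
      moreover have "0 \<le> mass \<phi>" by (intro integral_nonneg_AE AE_I2) simp
      ultimately have "mass \<phi> = 0" by linarith
      then show ?thesis using low[OF \<phi>] by simp
    qed
    show "\<exists>\<phi>\<in>form_dom b. mass \<phi> = 1 \<and> energy b V \<phi> < Inf S + e" if "e > 0" for e
      using cInf_lessD[OF ne, of "Inf S + e"] that by (auto simp: S_def)
  qed
qed


section \<open>The free resolvent and the residual of an approximate minimiser\<close>

lemma resolvent_weight:
  assumes "lam < 2"
  shows "min 1 (1 - lam / 2) > 0" "min 1 (1 - lam / 2) * wt b k \<le> wt b k - lam"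
    "0 < wt b k - lam"
proof -
  show "min 1 (1 - lam / 2) > 0" using assms by simp
  show "0 < wt b k - lam" using assms wt_ge_2[of b k] by linarith
  show "min 1 (1 - lam / 2) * wt b k \<le> wt b k - lam"
  \<comment> \<open>For \<open>lam \<le> 0\<close> the weight only grows; otherwise
    \<open>wt b k \<ge> 2\<close> gives \<open>lam \<le> lam * (wt b k / 2)\<close>, hence the
    factor \<open>1 - lam / 2\<close>.\<close>
  proof (cases "lam \<le> 0")
    case True
    have "min 1 (1 - lam / 2) * wt b k \<le> 1 * wt b k" by (intro mult_right_mono) auto
    then show ?thesis using True by linarith
  next
    case False
    have "min 1 (1 - lam / 2) * wt b k \<le> (1 - lam / 2) * wt b k"
      by (intro mult_right_mono) auto
    also have "\<dots> = wt b k - lam * (wt b k / 2)" by (simp add: algebra_simps)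
    also have "\<dots> \<le> wt b k - lam * 1"
      using False wt_ge_2[of b k] by (intro diff_left_mono mult_left_mono) auto
    finally show ?thesis by simp
  qed
qed

lemma integrable_resolvent:
  assumes "b > 0" "lam < 2"
  shows "integrable lborel (\<lambda>k. 1 / (wt b k - lam))"
  by (rule integrable_inverse_wt[OF assms(1) resolvent_weight(1)[OF assms(2)]])
    (auto intro: resolvent_weight(2)[OF assms(2)])

text \<open>The ratio \<open>wt b k / (wt b k - lam)\<close> is bounded, so one of the two resolvent
  factors absorbs the weight and the other remains as an integrable majorant.\<close>

lemma resolvent_form_dom:
  assumes b: "b > 0" and lam: "lam < 2" and [measurable]: "c \<in> borel_measurable borel"
    and C: "\<And>k. cmod (c k) \<le> C"
  shows "(\<lambda>k. c k / complex_of_real (wt b k - lam)) \<in> form_dom b"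
  unfolding form_dom_iff
proof
  show "(\<lambda>k. c k / complex_of_real (wt b k - lam)) \<in> borel_measurable borel" by measurable
  let ?m = "min 1 (1 - lam / 2)"
  show "integrable lborel (\<lambda>k. wt b k * (cmod (c k / complex_of_real (wt b k - lam)))\<^sup>2)"
  proof (rule Bochner_Integration.integrable_bound)
    show "integrable lborel (\<lambda>k. (C\<^sup>2 / ?m) * (1 / (wt b k - lam)))"
      by (intro integrable_mult_right integrable_resolvent assms)
    show "AE k in lborel. norm (wt b k * (cmod (c k / complex_of_real (wt b k - lam)))\<^sup>2)
        \<le> norm ((C\<^sup>2 / ?m) * (1 / (wt b k - lam)))"
    proof (rule AE_I2)
      fix k
      let ?w = "wt b k - lam"
      have w: "0 < ?w" by (rule resolvent_weight(3)[OF lam])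
      have m: "0 < ?m" by (rule resolvent_weight(1)[OF lam])
      have "wt b k * (cmod (c k / complex_of_real ?w))\<^sup>2 = (wt b k / ?w) * ((cmod (c k))\<^sup>2 / ?w)"
        using w by (simp only: norm_divide norm_of_real power_divide power2_abs) (simp add: power2_eq_square)
      also have "\<dots> \<le> (1 / ?m) * (C\<^sup>2 / ?w)"
      proof (intro mult_mono)
        show "wt b k / ?w \<le> 1 / ?m"
        proof -
          have "x / w \<le> 1 / m" if "m * x \<le> w" "0 < w" "0 < m" for x w m :: real
            using that by (simp add: field_simps)
          from this[OF resolvent_weight(2)[OF lam] w m] show ?thesis .
        qed
        show "(cmod (c k))\<^sup>2 / ?w \<le> C\<^sup>2 / ?w"
          using w C by (intro divide_right_mono power_mono) auto
      qed (use w m in auto)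
      also have "\<dots> = (C\<^sup>2 / ?m) * (1 / ?w)" by simp
      finally have "wt b k * (cmod (c k / complex_of_real ?w))\<^sup>2 \<le> (C\<^sup>2 / ?m) * (1 / ?w)" .
      moreover have "0 \<le> wt b k * (cmod (c k / complex_of_real ?w))\<^sup>2" by simp
      ultimately show "norm (wt b k * (cmod (c k / complex_of_real ?w))\<^sup>2) \<le> norm ((C\<^sup>2 / ?m) * (1 / ?w))"
        unfolding real_norm_def by linarith
    qed
  qed measurable
qed

lemma shifted_kinetic:
  assumes "\<phi> \<in> form_dom b"
  shows "integrable lborel (\<lambda>k. (wt b k - lam) * (cmod (\<phi> k))\<^sup>2)"
    and "(\<integral>k. (wt b k - lam) * (cmod (\<phi> k))\<^sup>2 \<partial>lborel) = energy b V \<phi> + pot_energy V \<phi> - lam * mass \<phi>"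
proof -
  have eq: "(wt b k - lam) * (cmod (\<phi> k))\<^sup>2 = wt b k * (cmod (\<phi> k))\<^sup>2 - lam * (cmod (\<phi> k))\<^sup>2" for k
    by (rule left_diff_distrib)
  show "integrable lborel (\<lambda>k. (wt b k - lam) * (cmod (\<phi> k))\<^sup>2)"
    unfolding eq by (intro Bochner_Integration.integrable_diff integrable_mult_right form_dom_wt[OF assms] form_dom_square[OF assms])
  have "(\<integral>k. (wt b k - lam) * (cmod (\<phi> k))\<^sup>2 \<partial>lborel)
      = (\<integral>k. wt b k * (cmod (\<phi> k))\<^sup>2 \<partial>lborel) - (\<integral>k. lam * (cmod (\<phi> k))\<^sup>2 \<partial>lborel)"
    unfolding eq by (intro Bochner_Integration.integral_diff integrable_mult_right form_dom_wt[OF assms] form_dom_square[OF assms])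
  then show "(\<integral>k. (wt b k - lam) * (cmod (\<phi> k))\<^sup>2 \<partial>lborel) = energy b V \<phi> + pot_energy V \<phi> - lam * mass \<phi>"
    unfolding energy_def integral_mult_right_zero by simp
qed

text \<open>With \<open>\<eta> = (W\<^sub>0 - \<lambda>)\<^sup>-\<^sup>1 V \<phi>\<close> and \<open>e = \<phi> - \<eta>\<close>, expanding the nonnegative form of
  \<open>W\<^sub>V - \<lambda>\<close> at \<open>\<eta> = \<phi> - e\<close> makes the cross terms of the kinetic and the potential part cancel.\<close>

lemma residual_le:
  assumes b: "b > 0" and V: "integrable lborel V" and V0: "AE x in lborel. V x \<ge> 0"
    and lam: "lam < 2" and low: "\<And>\<phi>. \<phi> \<in> form_dom b \<Longrightarrow> lam * mass \<phi> \<le> energy b V \<phi>"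
    and \<phi>: "\<phi> \<in> form_dom b"
  defines "e \<equiv> \<lambda>k. \<phi> k - pot V \<phi> k / complex_of_real (wt b k - lam)"
  shows "(\<integral>k. (wt b k - lam) * (cmod (e k))\<^sup>2 \<partial>lborel) \<le> energy b V \<phi> - lam * mass \<phi>"
proof -
  have \<phi>1: "integrable lborel \<phi>" by (rule form_dom_integrable[OF b \<phi>])
  define \<eta> where "\<eta> k = pot V \<phi> k / complex_of_real (wt b k - lam)" for k
  have \<eta>: "\<eta> \<in> form_dom b"
    unfolding \<eta>_def[abs_def]
    by (rule resolvent_form_dom[OF b lam borel_measurable_continuous_onI[OF continuous_pot[OF V \<phi>1]] pot_bound[OF V \<phi>1]])
  have e_eq: "e = (\<lambda>k. \<phi> k - \<eta> k)" and \<eta>_eq: "\<eta> = (\<lambda>k. \<phi> k - e k)"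
    by (auto simp: e_def \<eta>_def)
  have e: "e \<in> form_dom b" unfolding e_eq by (rule form_dom_diff[OF \<phi> \<eta>])
  have e1: "integrable lborel e" by (rule form_dom_integrable[OF b e])
  let ?N = "\<lambda>f. \<integral>k. (wt b k - lam) * (cmod (f k))\<^sup>2 \<partial>lborel"
  let ?R = "\<lambda>k. Re (pot V \<phi> k * cnj (e k))"
  have iR: "integrable lborel (\<lambda>k. pot V \<phi> k * cnj (e k))"
  proof (rule Bochner_Integration.integrable_bound)
    let ?C = "(\<integral>x. \<bar>V x\<bar> \<partial>lborel) * (\<integral>k. cmod (\<phi> k) \<partial>lborel)"
    have [measurable]: "pot V \<phi> \<in> borel_measurable borel" "e \<in> borel_measurable borel"
      by (rule borel_measurable_continuous_onI[OF continuous_pot[OF V \<phi>1]], rule form_dom_measurable[OF e])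
    show "(\<lambda>k. pot V \<phi> k * cnj (e k)) \<in> borel_measurable lborel" by measurable
    show "integrable lborel (\<lambda>k. ?C * cmod (e k))" using e1 by simp
    show "AE k in lborel. norm (pot V \<phi> k * cnj (e k)) \<le> norm (?C * cmod (e k))"
      using pot_bound[OF V \<phi>1] by (auto simp: norm_mult abs_mult intro!: mult_right_mono)
  qed
  have sq: "(cmod x)\<^sup>2 = (cmod (x + y))\<^sup>2 - (cmod y)\<^sup>2 - 2 * Re (x * cnj y)" for x y
    unfolding cmod_power2 by (simp add: power2_eq_square algebra_simps)
  have pw: "(wt b k - lam) * (cmod (\<eta> k))\<^sup>2
      = (wt b k - lam) * (cmod (\<phi> k))\<^sup>2 - (wt b k - lam) * (cmod (e k))\<^sup>2 - 2 * ?R k" for k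
  proof -
    \<comment> \<open>By the choice of \<open>\<eta>\<close>, the kinetic cross term with weight
      \<open>wt b k - lam\<close> equals the pairing of \<open>pot V \<phi>\<close> with
      \<open>e\<close>, which is also the cross term of the potential energy.\<close>
    have c: "pot V \<phi> k = complex_of_real (wt b k - lam) * \<eta> k"
      using resolvent_weight(3)[OF lam, of b k] unfolding \<eta>_def
      by (simp del: of_real_diff of_real_mult)
    have "?R k = (wt b k - lam) * Re (\<eta> k * cnj (e k))"
    proof -
      have "Re (complex_of_real r * x * y) = r * Re (x * y)" for r x y
        by (simp add: algebra_simps)
      then show ?thesis unfolding c .
    qed
    then show ?thesis
      using sq[of "\<eta> k" "e k"] unfolding e_eq by (simp only: right_diff_distrib) (simp add: algebra_simps)
  qed
  have "?N \<eta> = ?N \<phi> - ?N e - (\<integral>k. 2 * ?R k \<partial>lborel)"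
    unfolding pw using shifted_kinetic(1)[OF \<phi>] shifted_kinetic(1)[OF e] integrable_Re[OF iR]
    by (simp only: Bochner_Integration.integral_diff Bochner_Integration.integrable_diff integrable_mult_right)
  also have "(\<integral>k. 2 * ?R k \<partial>lborel) = 2 * Re (\<integral>k. pot V \<phi> k * cnj (e k) \<partial>lborel)"
    unfolding integral_mult_right_zero Bochner_Integration.integral_Re[OF iR] ..
  finally have N: "?N \<eta> = ?N \<phi> - ?N e - 2 * Re (\<integral>k. pot V \<phi> k * cnj (e k) \<partial>lborel)" .
  have P: "pot_energy V \<eta> = pot_energy V \<phi> - 2 * Re (\<integral>k. pot V \<phi> k * cnj (e k) \<partial>lborel) + pot_energy V e"
    unfolding \<eta>_eq by (rule pot_energy_diff[OF V \<phi>1 e1])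
  show "?N e \<le> energy b V \<phi> - lam * mass \<phi>"
    \<comment> \<open>The nonnegative form at \<open>\<eta>\<close> equals that at
      \<open>\<phi>\<close> minus the weighted square of \<open>e\<close> minus
      \<open>pot_energy V e\<close>; the last energy is nonnegative since V is.\<close>
    using N P low[OF \<eta>] shifted_kinetic(2)[OF \<eta>, of lam V] shifted_kinetic(2)[OF \<phi>, of lam V]
      pot_energy_nonneg[OF V0, of e] by linarith
qed

section \<open>Compactness of a minimising sequence\<close>

lemma pot_diff:
  assumes V: "integrable lborel V" and "integrable lborel f" "integrable lborel g"
  shows "pot V (\<lambda>k. f k - g k) k = pot V f k - pot V g k"
  unfolding pot_def four_inv_diff[OF assms(2,3)] right_diff_distrib
  by (rule four_inv_diff; rule integrable_V_four_inv[OF V]; fact)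

text \<open>Compactness comes from \<open>pot\<close>, whose values along a minimising sequence
  converge pointwise for a subsequence. Since \<open>lam < 2\<close>, the factor
  \<open>1 / (wt b k - lam)\<close> is integrable and upgrades this to \<open>L\<^sup>1\<close>
  convergence after the resolvent; the residuals vanish in \<open>L\<^sup>1\<close>, so the
  minimising subsequence converges too.\<close>

lemma Birman_Schwinger_solution:
  assumes b: "b > 0" and V: "integrable lborel V" and V0: "AE x in lborel. V x \<ge> 0"
    and nz: "\<not> (AE x in lborel. V x = 0)"
  obtains lam \<eta> where "lam < 2" "\<eta> \<in> form_dom b" "\<not> (AE k in lborel. \<eta> k = 0)"
    "\<And>k. \<eta> k = pot V \<eta> k / complex_of_real (wt b k - lam)"
proof -
  obtain lam where lam: "lam < 2"
    and low: "\<And>\<phi>. \<phi> \<in> form_dom b \<Longrightarrow> lam * mass \<phi> \<le> energy b V \<phi>"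
    and minim: "\<And>e. e > 0 \<Longrightarrow> \<exists>\<phi>\<in>form_dom b. mass \<phi> = 1 \<and> energy b V \<phi> < lam + e"
    using spectral_bottom[OF assms] by blast
  let ?d = "\<lambda>n. inverse (real (Suc n))"
  have "\<exists>\<phi>\<in>form_dom b. mass \<phi> = 1 \<and> energy b V \<phi> < lam + ?d n" for n
    by (rule minim) simp
  then obtain \<phi> where dom: "\<And>n. \<phi> n \<in> form_dom b" and mass: "\<And>n. mass (\<phi> n) = 1"
    and en: "\<And>n. energy b V (\<phi> n) < lam + ?d n"
    by metis
  have L1: "integrable lborel (\<phi> n)" for n by (rule form_dom_integrable[OF b dom])
  let ?v = "\<integral>x. \<bar>V x\<bar> \<partial>lborel"
  obtain s where s: "s \<ge> 0" and
    pe: "\<And>\<phi>. \<phi> \<in> form_dom b \<Longrightarrow> pot_energy V \<phi> \<le> ((\<integral>k. wt b k * (cmod (\<phi> k))\<^sup>2 \<partial>lborel) + s * mass \<phi>) / 2"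
    using potential_form_bounded[OF b V] by blast
  have iw: "integrable lborel (\<lambda>k. 1 / wt b k)"
    by (rule integrable_inverse_wt[OF b zero_less_one]) auto
  \<comment> \<open>The form bound together with energy below \<open>lam + 1\<close> bounds the
    kinetic integral by \<open>2 * (lam + 1) + s\<close>; Cauchy-Schwarz turns this into a common
    \<open>L\<^sup>1\<close> bound.\<close>
  define C where "C = sqrt ((\<integral>k. 1 / wt b k \<partial>lborel) * (2 * (lam + 1) + s))"
  have C: "(\<integral>k. cmod (\<phi> n k) \<partial>lborel) \<le> C" for n
    unfolding C_def
  proof (rule real_le_rsqrt)
    have d1: "?d n \<le> 1" by (simp add: inverse_le_1_iff)
    have kin: "(\<integral>k. wt b k * (cmod (\<phi> n k))\<^sup>2 \<partial>lborel) \<le> 2 * (lam + 1) + s"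
    proof -
      have "K \<le> 2 * (lam + 1) + s" if "P \<le> (K + s * 1) / 2" "K - P < lam + d" "d \<le> 1" for K P d
        using that by argo
      from this[OF pe[OF dom[of n], unfolded mass] en[of n, unfolded energy_def] d1]
      show ?thesis .
    qed
    have "(\<integral>k. cmod (\<phi> n k) \<partial>lborel)\<^sup>2 \<le> (\<integral>k. 1 / wt b k \<partial>lborel) * (\<integral>k. wt b k * (cmod (\<phi> n k))\<^sup>2 \<partial>lborel)"
      by (rule weighted_Cauchy_Schwarz(2)[OF _ iw form_dom_wt[OF dom] form_dom_measurable[OF dom]]) simp
    also have "\<dots> \<le> (\<integral>k. 1 / wt b k \<partial>lborel) * (2 * (lam + 1) + s)"
      by (intro mult_left_mono kin integral_nonneg_AE AE_I2) simp
    finally show "(\<integral>k. cmod (\<phi> n k) \<partial>lborel)\<^sup>2 \<le> \<dots>" .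
  qed
  define M where "M = ?v * C"
  have M: "cmod (pot V (\<phi> n) k) \<le> M" for n k
    using pot_bound[OF V L1] mult_left_mono[OF C, of ?v] unfolding M_def by (rule order_trans) simp
  let ?om = "\<lambda>h. C * (\<integral>x. \<bar>V x\<bar> * cmod (cis (2 * pi * x * (- h)) - 1) \<partial>lborel)"
  have osc: "cmod (pot V (\<phi> n) k - pot V (\<phi> n) l) \<le> ?om (k - l)" for n k l
    using pot_oscillation[OF V L1 C, of n k l] by simp
  have om: "(\<lambda>n. ?om (h n)) \<longlonglongrightarrow> 0" if "h \<longlonglongrightarrow> 0" for h
    using tendsto_mult_left[OF oscillation_tendsto_0[OF V, of "\<lambda>n. - h n"], of C] tendsto_minus[OF that] by simp
  obtain r c where r: "strict_mono (r :: nat \<Rightarrow> nat)" and c: "\<And>k. (\<lambda>n. pot V (\<phi> (r n)) k) \<longlonglongrightarrow> c k"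
    using equicontinuous_convergent_subseq[of "\<lambda>n. pot V (\<phi> n)" M ?om, OF M osc om] by blast
  have mc: "pot V (\<phi> n) \<in> borel_measurable borel" for n
    by (rule borel_measurable_continuous_onI[OF continuous_pot[OF V L1]])
  have [measurable]: "c \<in> borel_measurable borel"
    by (rule borel_measurable_LIMSEQ_metric[OF mc c])
  have cM: "cmod (c k) \<le> M" for k
    by (rule LIMSEQ_le_const2[OF tendsto_norm[OF c]]) (auto intro: M)
  let ?w = "\<lambda>k. complex_of_real (wt b k - lam)"
  \<comment> \<open>\<open>\<psi> n\<close> is the free resolvent applied to
    \<open>pot V (\<phi> (r n))\<close>, \<open>e n\<close> the residual, and \<open>\<eta>\<close>
    the pointwise limit of \<open>\<psi> n\<close>.\<close>
  define \<eta> where "\<eta> k = c k / ?w k" for k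
  define \<psi> where "\<psi> n k = pot V (\<phi> (r n)) k / ?w k" for n k
  define e where "e n k = \<phi> (r n) k - \<psi> n k" for n k
  have \<eta>: "\<eta> \<in> form_dom b"
    unfolding \<eta>_def[abs_def] by (rule resolvent_form_dom[OF b lam _ cM]) measurable
  have \<psi>: "\<psi> n \<in> form_dom b" for n
    unfolding \<psi>_def[abs_def] by (rule resolvent_form_dom[OF b lam mc M])
  have e: "e n \<in> form_dom b" for n
    unfolding e_def[abs_def] by (rule form_dom_diff[OF dom \<psi>])
  have int: "integrable lborel \<eta>" "integrable lborel (\<psi> n)" "integrable lborel (e n)" for n
    by (rule form_dom_integrable[OF b], fact)+
  let ?J = "\<integral>k. 1 / (wt b k - lam) \<partial>lborel"
  \<comment> \<open>The energy excess of \<open>\<phi> (r n)\<close> over \<open>lam\<close> bounds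
    the weighted square of the residual by \<open>residual_le\<close>; Cauchy-Schwarz with the same
    weight passes to the \<open>L\<^sup>1\<close> norm.\<close>
  have e_le: "(\<integral>k. cmod (e n k) \<partial>lborel) \<le> sqrt (?J * ?d (r n))" for n
  proof (rule real_le_rsqrt)
    have "(\<integral>k. cmod (e n k) \<partial>lborel)\<^sup>2 \<le> ?J * (\<integral>k. (wt b k - lam) * (cmod (e n k))\<^sup>2 \<partial>lborel)"
      by (rule weighted_Cauchy_Schwarz(2)[OF resolvent_weight(3)[OF lam] integrable_resolvent[OF b lam]
            shifted_kinetic(1)[OF e] form_dom_measurable[OF e]])
    also have "\<dots> \<le> ?J * ?d (r n)"
    proof (rule mult_left_mono)
      have "(\<integral>k. (wt b k - lam) * (cmod (e n k))\<^sup>2 \<partial>lborel) \<le> energy b V (\<phi> (r n)) - lam * mass (\<phi> (r n))"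
        unfolding e_def \<psi>_def by (rule residual_le[OF b V V0 lam low dom])
      then show "(\<integral>k. (wt b k - lam) * (cmod (e n k))\<^sup>2 \<partial>lborel) \<le> ?d (r n)"
        using en[of "r n"] unfolding mass by linarith
      show "0 \<le> ?J"
        using resolvent_weight(3)[OF lam] by (intro integral_nonneg_AE AE_I2) (simp add: less_imp_le)
    qed
    finally show "(\<integral>k. cmod (e n k) \<partial>lborel)\<^sup>2 \<le> ?J * ?d (r n)" .
  qed
  have "(\<lambda>n. ?d (r n)) \<longlonglongrightarrow> 0"
    using LIMSEQ_subseq_LIMSEQ[OF LIMSEQ_inverse_real_of_nat r] by (simp add: o_def)
  from tendsto_real_sqrt[OF tendsto_mult_left[OF this, of ?J]]
  have e_lim: "(\<lambda>n. sqrt (?J * ?d (r n))) \<longlonglongrightarrow> 0" by simp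
  have "(\<lambda>n. \<integral>k. cmod (\<psi> n k - \<eta> k) \<partial>lborel) \<longlonglongrightarrow> (\<integral>k. 0 \<partial>(lborel :: real measure))"
  proof (rule integral_dominated_convergence)
    have [measurable]: "\<psi> n \<in> borel_measurable borel" "\<eta> \<in> borel_measurable borel" for n
      by (rule form_dom_measurable, fact)+
    show "(\<lambda>k. cmod (\<psi> n k - \<eta> k)) \<in> borel_measurable lborel" for n by measurable
    show "integrable lborel (\<lambda>k. (2 * M) * (1 / (wt b k - lam)))"
      by (intro integrable_mult_right integrable_resolvent b lam)
    show "AE k in lborel. (\<lambda>n. cmod (\<psi> n k - \<eta> k)) \<longlonglongrightarrow> 0"
    proof (rule AE_I2)
      fix k
      have "(\<lambda>n. \<psi> n k) \<longlonglongrightarrow> \<eta> k"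
        unfolding \<psi>_def \<eta>_def using resolvent_weight(3)[OF lam, of b k]
        by (intro tendsto_divide c tendsto_const) (simp del: of_real_diff of_real_mult)
      then show "(\<lambda>n. cmod (\<psi> n k - \<eta> k)) \<longlonglongrightarrow> 0"
        by (intro tendsto_norm_zero) (simp add: LIM_zero)
    qed
    show "AE k in lborel. norm (cmod (\<psi> n k - \<eta> k)) \<le> (2 * M) * (1 / (wt b k - lam))" for n
    proof (rule AE_I2)
      fix k
      have "cmod (\<psi> n k - \<eta> k) = cmod (pot V (\<phi> (r n)) k - c k) / (wt b k - lam)"
        unfolding \<psi>_def \<eta>_def diff_divide_distrib[symmetric] norm_divide norm_of_real
        using resolvent_weight(3)[OF lam, of b k] by simp
      also have "\<dots> \<le> (2 * M) / (wt b k - lam)"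
        using norm_triangle_ineq4[of "pot V (\<phi> (r n)) k" "c k"] M[of "r n" k] cM[of k]
          resolvent_weight(3)[OF lam, of b k] by (intro divide_right_mono) auto
      finally show "norm (cmod (\<psi> n k - \<eta> k)) \<le> (2 * M) * (1 / (wt b k - lam))" by simp
    qed
  qed simp
  from tendsto_add[OF this e_lim]
  have lim: "(\<lambda>n. (\<integral>k. cmod (\<psi> n k - \<eta> k) \<partial>lborel) + sqrt (?J * ?d (r n))) \<longlonglongrightarrow> 0" by simp
  have diff_le: "(\<integral>k. cmod (\<phi> (r n) k - \<eta> k) \<partial>lborel)
      \<le> (\<integral>k. cmod (\<psi> n k - \<eta> k) \<partial>lborel) + sqrt (?J * ?d (r n))" for n
  proof -
    have "(\<integral>k. cmod (\<phi> (r n) k - \<eta> k) \<partial>lborel) \<le> (\<integral>k. cmod (\<psi> n k - \<eta> k) + cmod (e n k) \<partial>lborel)"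
    proof (rule integral_mono)
      show "cmod (\<phi> (r n) k - \<eta> k) \<le> cmod (\<psi> n k - \<eta> k) + cmod (e n k)" for k
        using norm_triangle_ineq[of "\<psi> n k - \<eta> k" "e n k"] by (simp add: e_def)
    qed (use int L1 in auto)
    also have "\<dots> = (\<integral>k. cmod (\<psi> n k - \<eta> k) \<partial>lborel) + (\<integral>k. cmod (e n k) \<partial>lborel)"
      using int by (intro Bochner_Integration.integral_add) auto
    finally show ?thesis using e_le[of n] by linarith
  qed
  have L1lim: "(\<lambda>n. \<integral>k. cmod (\<phi> (r n) k - \<eta> k) \<partial>lborel) \<longlonglongrightarrow> 0"
    by (rule Lim_null_comparison[OF always_eventually lim]) (use diff_le in simp)
  \<comment> \<open>By \<open>pot_bound\<close>, \<open>pot\<close> is continuous from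
    \<open>L\<^sup>1\<close> to pointwise values, so the limit function is identified.\<close>
  have "c k = pot V \<eta> k" for k
  proof (rule LIMSEQ_unique[OF c])
    have "(\<lambda>n. pot V (\<phi> (r n)) k - pot V \<eta> k) \<longlonglongrightarrow> 0"
    proof (rule Lim_null_comparison)
      show "\<forall>\<^sub>F n in sequentially. norm (pot V (\<phi> (r n)) k - pot V \<eta> k)
          \<le> ?v * (\<integral>k. cmod (\<phi> (r n) k - \<eta> k) \<partial>lborel)"
        unfolding pot_diff[OF V L1 int(1), symmetric]
        by (intro always_eventually allI pot_bound[OF V] Bochner_Integration.integrable_diff L1 int)
      show "(\<lambda>n. ?v * (\<integral>k. cmod (\<phi> (r n) k - \<eta> k) \<partial>lborel)) \<longlonglongrightarrow> 0"
        using tendsto_mult_left[OF L1lim, of ?v] by simp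
    qed
    then show "(\<lambda>n. pot V (\<phi> (r n)) k) \<longlonglongrightarrow> pot V \<eta> k" by (simp add: LIM_zero_iff)
  qed
  then have eq: "\<eta> k = pot V \<eta> k / ?w k" for k by (simp add: \<eta>_def)
  \<comment> \<open>If the limit vanished, the \<open>L\<^sup>1\<close> norms and hence the
    potential energies would tend to 0. The kinetic energy of a normalised state is at least 2, so
    the limit of the energies would force \<open>2 \<le> lam\<close>.\<close>
  have "\<not> (AE k in lborel. \<eta> k = 0)"
  proof
    assume z: "AE k in lborel. \<eta> k = 0"
    have "(\<integral>k. cmod (\<phi> (r n) k - \<eta> k) \<partial>lborel) = (\<integral>k. cmod (\<phi> (r n) k) \<partial>lborel)" for n
      by (rule integral_cong_AE) (use z int L1 in \<open>auto intro: borel_measurable_integrable\<close>)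
    then have "(\<lambda>n. \<integral>k. cmod (\<phi> (r n) k) \<partial>lborel) \<longlonglongrightarrow> 0"
      using L1lim by simp
    from tendsto_diff[OF tendsto_const tendsto_mult_left[OF tendsto_power[OF this, of 2], of ?v], of 2]
    have l1: "(\<lambda>n. 2 - ?v * (\<integral>k. cmod (\<phi> (r n) k) \<partial>lborel)\<^sup>2) \<longlonglongrightarrow> 2" by simp
    have l2: "(\<lambda>n. lam + ?d (r n)) \<longlonglongrightarrow> lam"
      using tendsto_add[OF tendsto_const \<open>(\<lambda>n. ?d (r n)) \<longlonglongrightarrow> 0\<close>, of lam] by simp
    have "2 - ?v * (\<integral>k. cmod (\<phi> (r n) k) \<partial>lborel)\<^sup>2 \<le> lam + ?d (r n)" for n
    proof -
      have "(\<integral>k. 2 * (cmod (\<phi> (r n) k))\<^sup>2 \<partial>lborel) \<le> (\<integral>k. wt b k * (cmod (\<phi> (r n) k))\<^sup>2 \<partial>lborel)"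
        by (rule integral_mono[OF integrable_mult_right[OF form_dom_square[OF dom]] form_dom_wt[OF dom]])
          (intro mult_right_mono wt_ge_2, simp)
      then have "2 \<le> (\<integral>k. wt b k * (cmod (\<phi> (r n) k))\<^sup>2 \<partial>lborel)"
        by (simp only: integral_mult_right_zero mass mult_1_right)
      then show ?thesis
        using en[of "r n"] pot_energy_le[OF V L1, of "r n"] unfolding energy_def by linarith
    qed
    from LIMSEQ_le[OF l1 l2] this lam show False by fastforce
  qed
  from that[OF lam \<eta> this eq] show thesis .
qed

section \<open>From the fixed-point equation to the weak eigenvalue equation\<close>

theorem theorem2p1:
  fixes b :: real and V :: "real \<Rightarrow> real"
  assumes "b > 0"
    and "integrable lborel V"
    and "AE x in lborel. V x \<ge> 0"
    and "\<not> (AE x in lborel. V x = 0)"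
  shows "\<exists>mu < 2. is_eigenvalue_WV b V mu"
proof -
  note b = assms(1) and V = assms(2)
  obtain lam \<eta> where lam: "lam < 2" and \<eta>: "\<eta> \<in> form_dom b" and nz: "\<not> (AE k in lborel. \<eta> k = 0)"
    and eq: "\<And>k. \<eta> k = pot V \<eta> k / complex_of_real (wt b k - lam)"
    using Birman_Schwinger_solution[OF assms] by blast
  have \<eta>1: "integrable lborel \<eta>" by (rule form_dom_integrable[OF b \<eta>])
  have w: "0 < wt b k - lam" for k by (rule resolvent_weight(3)[OF lam])
  have w0: "complex_of_real (wt b k - lam) \<noteq> 0" for k
    using w[of k] by (simp only: of_real_eq_0_iff)
  have pot_eq: "pot V \<eta> k = complex_of_real (wt b k - lam) * \<eta> k" for k
    using eq[of k] w0[of k] by (simp add: field_simps del: of_real_diff of_real_mult)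
  \<comment> \<open>The fixed-point equation transfers continuity and boundedness from
    \<open>pot V \<eta>\<close> to \<open>\<eta>\<close>, as required by
    \<open>Plancherel_continuous\<close>.\<close>
  have "continuous_on UNIV (\<lambda>k. pot V \<eta> k / complex_of_real (wt b k - lam))"
    using w0 by (intro continuous_on_divide continuous_pot[OF V \<eta>1] continuous_intros) auto
  then have cont: "continuous_on UNIV \<eta>" by (simp only: eq[symmetric])
  have bd: "cmod (\<eta> k) \<le> (\<integral>x. \<bar>V x\<bar> \<partial>lborel) * (\<integral>k. cmod (\<eta> k) \<partial>lborel) / (2 - lam)" for k
  proof -
    have "cmod (\<eta> k) = cmod (pot V \<eta> k) / (wt b k - lam)"
      using w[of k] by (subst eq) (simp only: norm_divide norm_of_real abs_of_pos)
    also have "\<dots> \<le> (\<integral>x. \<bar>V x\<bar> \<partial>lborel) * (\<integral>k. cmod (\<eta> k) \<partial>lborel) / (2 - lam)"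
      using lam wt_ge_2[of b k] by (intro frac_le pot_bound[OF V \<eta>1]) auto
    finally show ?thesis .
  qed
  have "WV_form b V \<eta> g = complex_of_real lam * (\<integral>x. four_inv \<eta> x * cnj (four_inv g x) \<partial>lborel)"
    if g: "g \<in> form_dom b" for g
  proof -
    have g1: "integrable lborel g" by (rule form_dom_integrable[OF b g])
    have i1: "integrable lborel (\<lambda>k. complex_of_real (wt b k) * \<eta> k * cnj (g k))"
    proof (rule form_dom_sesquilinear_integrable[OF \<eta> g, where C = 1])
      show "cmod (complex_of_real (wt b k)) \<le> 1 * wt b k" for k
        unfolding norm_of_real by simp
    qed measurable
    have i2: "integrable lborel (\<lambda>k. complex_of_real lam * \<eta> k * cnj (g k))"
    proof (rule form_dom_sesquilinear_integrable[OF \<eta> g, where C = "\<bar>lam\<bar>"])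
      show "cmod (complex_of_real lam) \<le> \<bar>lam\<bar> * wt b k" for k
        using wt_ge_2[of b k] mult_left_mono[of 1 "wt b k" "\<bar>lam\<bar>"] by simp
    qed measurable
    have "pot V \<eta> k * cnj (g k)
        = complex_of_real (wt b k) * \<eta> k * cnj (g k) - complex_of_real lam * \<eta> k * cnj (g k)" for k
      unfolding pot_eq of_real_diff by (simp only: left_diff_distrib)
    then have "(\<integral>k. pot V \<eta> k * cnj (g k) \<partial>lborel)
        = (\<integral>k. complex_of_real (wt b k) * \<eta> k * cnj (g k) \<partial>lborel) - (\<integral>k. complex_of_real lam * \<eta> k * cnj (g k) \<partial>lborel)"
      by (simp only: Bochner_Integration.integral_diff[OF i1 i2])
    then have "WV_form b V \<eta> g = (\<integral>k. complex_of_real lam * \<eta> k * cnj (g k) \<partial>lborel)"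
      unfolding WV_form_def pot_form[OF V \<eta>1 g1] by (simp only: diff_diff_eq2 add_diff_cancel_left')
    also have "\<dots> = complex_of_real lam * (\<integral>k. \<eta> k * cnj (g k) \<partial>lborel)"
      by (simp only: mult.assoc integral_mult_right_zero)
    \<comment> \<open>The form calculation ends with a Fourier-space pairing, whereas
      \<open>is_eigenvalue_WV\<close> uses the inner product in position space.\<close>
    also have "(\<integral>k. \<eta> k * cnj (g k) \<partial>lborel) = (\<integral>x. four_inv \<eta> x * cnj (four_inv g x) \<partial>lborel)"
      by (rule Plancherel_continuous[OF \<eta>1 form_dom_square[OF \<eta>] g1 form_dom_square[OF g] cont bd, symmetric])
    finally show ?thesis .
  qed
  then show ?thesis
    unfolding is_eigenvalue_WV_def using lam \<eta> nz by blast
qed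

end
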